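(* Let $m = m(n)$, $n = 1, 2, \ldots$, be a sequence of positive integers such that $m \gg \ln^3 n$, i.e. $(\ln n)^3/m(n)\to 0$ as $n\to\infty$. Then, for any fixed $y \in \mathbb{R}$, $$\lim_{n \rightarrow \infty} \mathbb{P}\left\{\frac{D_{m,n} - n m - n \sqrt{m}\, \sqrt{2\ln n - \ln \ln n}}{n \sqrt{ m/(2\ln n)}} \leq y\right\} = \exp \left(-\frac{e^{-y}}{2\sqrt{\pi}}\right)$$ or, equivalently, $$\sqrt{2 m \ln n} \left( \frac{D_{m,n}}{n m} -1 \right) - 2\ln n + \frac{\ln \ln n}{2} + \ln\left(2\sqrt{\pi}\right) \, \overset{d}{\longrightarrow} \, G \qquad (n\to\infty),$$ where $G$ is the standard Gumbel random variable.
   Context: Coupon collector setting: $n$ equally likely coupons are sampled independently with replacement (each trial yields coupon $j$ with probability $1/n$, $j=1,\dots,n$). For positive integers $m,n$, $D_{m,n}$ denotes the number of trials needed until all $n$ coupons have been detected at least $m$ times each. The standard Gumbel random variable $G$ has distribution function $\mathbb{P}\{G\le y\}=e^{-e^{-y}}$, $y\in\mathbb{R}$. The symbol $\overset{d}{\longrightarrow}$ denotes convergence in distribution. Expressions involving $\ln n$ in a denominator or $\ln\ln n$ are considered for $n\ge 2$. *)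

theory Defs
  imports "HOL-Probability.Probability"
begin

text \<open>
  Trials are numbered from 0, so that after \<open>T\<close> trials the observed coupons are
  \<open>X 0 \<omega>, \<dots>, X (T - 1) \<omega>\<close>.
\<close>

locale coupon_collector = prob_space M for M :: "'a measure" +
  fixes n :: nat and X :: "nat \<Rightarrow> 'a \<Rightarrow> nat"
  assumes indep_trials: "indep_vars (\<lambda>_. count_space {1..n}) X UNIV"
    and uniform_trials: "\<And>t j. j \<in> {1..n} \<Longrightarrow> prob {\<omega> \<in> space M. X t \<omega> = j} = 1 / real n"

text \<open>
  On the null event that some coupon is drawn fewer than \<open>m\<close> times in total, no such \<open>T\<close> exists
  and \<open>LEAST\<close> returns an unspecified natural number; this does not affect the distribution.
\<close>

definition detection_time :: "nat \<Rightarrow> nat \<Rightarrow> (nat \<Rightarrow> 'a \<Rightarrow> nat) \<Rightarrow> 'a \<Rightarrow> nat" where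
  "detection_time m n X \<omega> = (LEAST T. \<forall>j\<in>{1..n}. m \<le> card {t \<in> {..<T}. X t \<omega> = j})"

definition gumbel :: "real measure" where
  "gumbel = interval_measure (\<lambda>y. exp (- exp (- y)))"

lemma
  shows real_distribution_gumbel: "real_distribution gumbel"
    and cdf_gumbel: "cdf gumbel y = exp (- exp (- y))"
proof -
  let ?F = "\<lambda>y::real. exp (- exp (- y))"
  have mono: "\<And>x y. x \<le> y \<Longrightarrow> ?F x \<le> ?F y" by simp
  have cont: "\<And>a. continuous (at_right a) ?F" by (intro continuous_intros)
  have bot: "(?F \<longlongrightarrow> 0) at_bot"
    by (rule filterlim_compose[OF exp_at_bot])
      (simp add: filterlim_uminus_at_bot filterlim_compose[OF exp_at_top] filterlim_uminus_at_top_at_bot)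
  have "((\<lambda>y::real. exp (- y)) \<longlongrightarrow> 0) at_top"
    by (rule filterlim_compose[OF exp_at_bot filterlim_uminus_at_bot_at_top])
  from tendsto_exp[OF tendsto_minus[OF this]] have top: "(?F \<longlongrightarrow> 1) at_top" by simp
  show "real_distribution gumbel"
    unfolding gumbel_def by (rule real_distribution_interval_measure[OF mono cont bot top])
  show "cdf gumbel y = exp (- exp (- y))"
    unfolding gumbel_def by (simp add: cdf_interval_measure[OF mono cont bot])
qed

end

theory Submission
  imports Defs "HOL-Real_Asymp.Real_Asymp"
begin

text \<open>
  Poissonization. Let \<open>Q T\<close> be the probability that every coupon has appeared \<open>m\<close> times among the first
  \<open>T\<close> trials. Counting words through exponential generating functions shows that the average of
  \<open>Q\<close> over a Poisson time with mean \<open>\<mu>\<close> is \<open>P(N \<ge> m)\<^sup>n\<close> with \<open>N\<close> Poisson of mean \<open>\<mu> / n\<close>. Since \<open>Q\<close>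
  is monotone and the Poisson time fluctuates by \<open>\<surd>\<mu>\<close>, which is negligible on the scale
  \<open>n \<surd>(m / (2 ln n))\<close>, this average determines the limit of \<open>Q\<close>. It remains to find
  \<open>P(N < m)\<close> at mean \<open>m + a \<surd>m\<close> with \<open>a \<sim> \<surd>(2 ln n)\<close>. By Stirling's formula the largest term of this sum
  is asymptotic to \<open>exp (- a\<^sup>2 / 2) / \<surd>(2 \<pi> m)\<close>, because the cubic correction \<open>a\<^sup>3 / \<surd>m\<close> vanishes exactly when
  \<open>m\<close> grows faster than \<open>ln\<^sup>3 n\<close>; the terms decay geometrically with ratio about \<open>1 - a / \<surd>m\<close>, which
  contributes the factor \<open>\<surd>m / a\<close>. So \<open>n P(N < m)\<close> converges, and \<open>(1 - P(N < m))\<^sup>n\<close> has the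
  stated double exponential limit.
\<close>

subsection \<open>Words with prescribed minimal multiplicities\<close>

text \<open>The positions form an arbitrary set \<open>A\<close> rather than \<open>{..<T}\<close>,
  because the recursion on the alphabet deletes the positions of one letter and leaves a set with
  gaps. Extensional functions make each word a single object, so that words can be counted.\<close>

definition full_words :: "nat \<Rightarrow> nat \<Rightarrow> 'b set \<Rightarrow> ('b \<Rightarrow> nat) set" where
  "full_words m n A = {f \<in> A \<rightarrow>\<^sub>E {1..n}. \<forall>j\<in>{1..n}. m \<le> card {t \<in> A. f t = j}}"

text \<open>The exponential generating function, by length, of words over one letter with at least
  \<open>m\<close> occurrences. Its \<open>n\<close>-th power therefore belongs to alphabets of size
  \<open>n\<close>.\<close>

definition exp_tail_fps :: "nat \<Rightarrow> real fps" where
  "exp_tail_fps m = fps_exp 1 - fps_of_poly (\<Sum>k<m. monom (1 / fact k) k)"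

lemma exp_tail_fps_nth: "fps_nth (exp_tail_fps m) k = (if m \<le> k then 1 / fact k else 0)"
  by (auto simp: exp_tail_fps_def coeff_sum)

lemma eval_exp_tail_fps: "eval_fps (exp_tail_fps m) x = exp x - (\<Sum>k<m. x ^ k / fact k)"
  unfolding exp_tail_fps_def
  by (subst eval_fps_diff) (auto simp: poly_sum poly_monom)

lemma fps_conv_radius_exp_tail_fps: "fps_conv_radius (exp_tail_fps m) = \<infinity>"
proof -
  have "min (fps_conv_radius (fps_exp (1::real)))
      (fps_conv_radius (fps_of_poly (\<Sum>k<m. monom (1 / fact k :: real) k)))
      \<le> fps_conv_radius (exp_tail_fps m)"
    unfolding exp_tail_fps_def by (rule fps_conv_radius_diff)
  then show ?thesis by simp
qed

lemma finite_full_words: "finite A \<Longrightarrow> finite (full_words m n A)"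
  unfolding full_words_def by (rule finite_subset[OF _ finite_PiE[of A "\<lambda>_. {1..n}"]]) auto

lemma sum_Pow_card:
  fixes h :: "nat \<Rightarrow> real"
  assumes "finite A"
  shows "(\<Sum>B\<in>Pow A. h (card B)) = (\<Sum>k\<le>card A. real (card A choose k) * h k)"
proof -
  have "(\<Sum>B\<in>Pow A. h (card B)) = (\<Sum>k\<le>card A. \<Sum>B\<in>{B \<in> Pow A. card B = k}. h (card B))"
    using assms by (intro sum.group[symmetric]) (auto simp: card_mono)
  also have "\<dots> = (\<Sum>k\<le>card A. real (card A choose k) * h k)"
    using n_subsets[OF assms] by (intro sum.cong) auto
  finally show ?thesis .
qed

text \<open>A word is determined by the set \<open>B\<close> of positions carrying the new letter
  \<open>Suc n\<close> and by the remaining word on \<open>A - B\<close>; the two multiplicity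
  conditions are independent of each other.\<close>

lemma card_full_words_Suc:
  assumes "finite A"
  shows "card (full_words m (Suc n) A) = (\<Sum>B\<in>{B \<in> Pow A. m \<le> card B}. card (full_words m n (A - B)))"
proof -
  let ?S = "SIGMA B:{B \<in> Pow A. m \<le> card B}. full_words m n (A - B)"
  \<comment> \<open>\<open>?f\<close> writes the new letter on \<open>B\<close>, and
    \<open>?g\<close> reads \<open>B\<close> off and forgets it. Both results are restricted, since
    words are extensional on their position sets.\<close>
  let ?f = "\<lambda>(B, g). \<lambda>t\<in>A. if t \<in> B then Suc n else g t"
  let ?g = "\<lambda>f. ({t \<in> A. f t = Suc n}, restrict f (A - {t \<in> A. f t = Suc n}))"
  have "bij_betw ?f ?S (full_words m (Suc n) A)"
  proof (rule bij_betw_byWitness[where f' = ?g])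
    show "\<forall>a\<in>?S. ?g (?f a) = a"
    proof
      fix p assume "p \<in> ?S"
      then obtain B g where p: "p = (B, g)" and *: "B \<subseteq> A" "m \<le> card B" "g \<in> full_words m n (A - B)"
        by auto
      from * have 1: "t \<in> A - B \<Longrightarrow> g t \<le> n" for t
        by (auto simp: full_words_def PiE_iff)
      have "t \<in> B \<or> g t \<noteq> Suc n" if "t \<in> A" for t
        using 1[of t] that by auto
      then have 2: "{t \<in> A. ?f (B, g) t = Suc n} = B"
        using * by (auto split: if_splits)
      have "restrict (?f (B, g)) (A - B) = g"
        using * by (auto simp: full_words_def PiE_iff extensional_def fun_eq_iff)
      with 2 show "?g (?f p) = p" unfolding p by simp
    qed
    show "\<forall>f\<in>full_words m (Suc n) A. ?f (?g f) = f"
      by (auto simp: full_words_def PiE_iff extensional_def fun_eq_iff)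
    show "?f ` ?S \<subseteq> full_words m (Suc n) A"
    proof (rule image_subsetI)
      fix p assume "p \<in> ?S"
      then obtain B g where p: "p = (B, g)" and *: "B \<subseteq> A" "m \<le> card B" "g \<in> full_words m n (A - B)"
        by auto
      from * have 1: "t \<in> A - B \<Longrightarrow> g t \<in> {1..n}" for t
        by (auto simp: full_words_def PiE_iff)
      have 2: "{t \<in> A. ?f (B, g) t = j} = (if j = Suc n then B else {t \<in> A - B. g t = j})" if "j \<in> {1..Suc n}" for j
        using 1 * by (auto split: if_splits) fastforce+
      have "?f (B, g) \<in> A \<rightarrow>\<^sub>E {1..Suc n}" using 1 by (auto simp: PiE_iff) (meson le_SucI)
      moreover have "m \<le> card {t \<in> A. ?f (B, g) t = j}" if "j \<in> {1..Suc n}" for j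
        unfolding 2[OF that] using * that by (auto simp: full_words_def)
      ultimately show "?f p \<in> full_words m (Suc n) A" unfolding p by (simp add: full_words_def)
    qed
    show "?g ` full_words m (Suc n) A \<subseteq> ?S"
    proof (rule image_subsetI)
      fix f assume f: "f \<in> full_words m (Suc n) A"
      then have "m \<le> card {t \<in> A. f t = Suc n}" by (auto simp: full_words_def)
      let ?B = "{t \<in> A. f t = Suc n}"
      have "restrict f (A - ?B) \<in> (A - ?B) \<rightarrow>\<^sub>E {1..n}"
        using f by (auto simp: full_words_def PiE_iff)
      moreover have "{t \<in> A - ?B. restrict f (A - ?B) t = j} = {t \<in> A. f t = j}" if "j \<in> {1..n}" for j
        using that by auto
      ultimately have "restrict f (A - ?B) \<in> full_words m n (A - ?B)"
        using f by (simp add: full_words_def)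
      with \<open>m \<le> card ?B\<close> show "?g f \<in> ?S" by auto
    qed
  qed
  then have "card (full_words m (Suc n) A) = card ?S" by (simp add: bij_betw_same_card)
  also have "\<dots> = (\<Sum>B\<in>{B \<in> Pow A. m \<le> card B}. card (full_words m n (A - B)))"
    using assms by (subst card_SigmaI) (auto simp: finite_full_words)
  finally show ?thesis .
qed

text \<open>The recursion depends on \<open>B\<close> only through its size, so it is a binomial
  convolution, and this is multiplication of exponential generating functions.\<close>

lemma card_full_words:
  "finite A \<Longrightarrow> real (card (full_words m n A)) = fact (card A) * fps_nth (exp_tail_fps m ^ n) (card A)"
proof (induction n arbitrary: A)
  case 0
  then show ?case by (cases "A = {}") (auto simp: full_words_def PiE_eq_empty_iff)
next
  case (Suc n)
  define c where "c k = fps_nth (exp_tail_fps m ^ n) k" for k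
  define h where "h k = (if m \<le> k then fact (card A - k) * c (card A - k) else 0)" for k
  have "real (card (full_words m (Suc n) A)) = (\<Sum>B\<in>{B \<in> Pow A. m \<le> card B}. h (card B))"
    unfolding card_full_words_Suc[OF Suc.prems] of_nat_sum
  proof (rule sum.cong)
    fix B assume "B \<in> {B \<in> Pow A. m \<le> card B}"
    moreover from this have "finite B" using Suc.prems by (auto intro: finite_subset)
    ultimately show "real (card (full_words m n (A - B))) = h (card B)"
      using Suc.prems by (simp add: Suc.IH h_def c_def card_Diff_subset)
  qed simp
  also have "\<dots> = (\<Sum>B\<in>Pow A. h (card B))"
    using Suc.prems by (intro sum.mono_neutral_left) (auto simp: h_def)
  also have "\<dots> = (\<Sum>k\<le>card A. real (card A choose k) * h k)"
    by (rule sum_Pow_card[OF Suc.prems])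
  also have "\<dots> = (\<Sum>k\<le>card A. fact (card A) * (fps_nth (exp_tail_fps m) k * c (card A - k)))"
    by (intro sum.cong) (auto simp: h_def exp_tail_fps_nth binomial_fact field_simps)
  also have "\<dots> = fact (card A) * fps_nth (exp_tail_fps m ^ Suc n) (card A)"
    by (simp add: fps_mult_nth c_def sum_distrib_left atMost_atLeast0)
  finally show ?case .
qed

definition poisson_below :: "nat \<Rightarrow> real \<Rightarrow> real" where
  "poisson_below m x = (\<Sum>k<m. exp (- x) * x ^ k / fact k)"

text \<open>Evaluate the generating function at \<open>\<mu> / n\<close> and distribute
  \<open>exp (- \<mu>)\<close> evenly over its \<open>n\<close> factors. This is Poisson splitting:
  at a Poisson time the letter counts are independent, each Poisson of mean
  \<open>\<mu> / n\<close>.\<close>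

lemma sums_poisson_full_words:
  assumes "n \<ge> 1"
  shows "(\<lambda>T. exp (- \<mu>) * \<mu> ^ T / fact T * (real (card (full_words m n {..<T})) / real n ^ T))
    sums (1 - poisson_below m (\<mu> / real n)) ^ n"
proof -
  let ?F = "exp_tail_fps m"
  have r: "fps_conv_radius (?F ^ n) = \<infinity>"
    using fps_conv_radius_power[of ?F n] by (simp add: fps_conv_radius_exp_tail_fps)
  have "(\<lambda>T. fps_nth (?F ^ n) T * (\<mu> / real n) ^ T) sums eval_fps (?F ^ n) (\<mu> / real n)"
    by (rule sums_eval_fps) (simp add: r)
  then have "(\<lambda>T. exp (- \<mu>) * (fps_nth (?F ^ n) T * (\<mu> / real n) ^ T)) sums
      (exp (- \<mu>) * eval_fps (?F ^ n) (\<mu> / real n))"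
    by (rule sums_mult)
  also have "exp (- \<mu>) * eval_fps (?F ^ n) (\<mu> / real n) = (exp (- (\<mu> / real n)) * eval_fps ?F (\<mu> / real n)) ^ n"
    using assms by (simp add: eval_fps_power fps_conv_radius_exp_tail_fps power_mult_distrib
        exp_of_nat_mult[symmetric])
  also have "exp (- (\<mu> / real n)) * eval_fps ?F (\<mu> / real n) = 1 - poisson_below m (\<mu> / real n)"
    by (simp add: eval_exp_tail_fps poisson_below_def right_diff_distrib sum_distrib_left exp_minus)
  also have "(\<lambda>T. exp (- \<mu>) * (fps_nth (?F ^ n) T * (\<mu> / real n) ^ T)) =
      (\<lambda>T. exp (- \<mu>) * \<mu> ^ T / fact T * (real (card (full_words m n {..<T})) / real n ^ T))"
    by (simp add: card_full_words power_divide fun_eq_iff)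
  finally show ?thesis .
qed

subsection \<open>Averages over a Poisson time\<close>

text \<open>Factorial moments come from an index shift: the weights satisfy
  \<open>p (T + 1) * (T + 1) = \<mu> * p T\<close>, and the term at 0 vanishes. The variance is
  recombined from \<open>T * (T - 1)\<close>, \<open>T\<close> and 1.\<close>

lemma sums_poisson_variance:
  fixes \<mu> :: real
  shows "(\<lambda>T. exp (- \<mu>) * \<mu> ^ T / fact T) sums 1" (is "?p sums 1")
    and "(\<lambda>T. exp (- \<mu>) * \<mu> ^ T / fact T * (real T - \<mu>)\<^sup>2) sums \<mu>"
proof -
  show p: "?p sums 1"
    using sums_mult[OF exp_converges[of \<mu>], of "exp (- \<mu>)"]
    by (simp add: exp_minus divide_inverse mult_ac)
  have 1: "(\<lambda>T. ?p T * real T) sums \<mu>"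
  proof -
    have "(\<lambda>T. ?p (Suc T) * real (Suc T)) = (\<lambda>T. \<mu> * ?p T)"
      by (simp add: fun_eq_iff divide_simps)
    with sums_mult[OF p, of \<mu>] have "(\<lambda>T. ?p (Suc T) * real (Suc T)) sums \<mu>" by simp
    then show ?thesis by (subst (asm) sums_Suc_iff) simp
  qed
  have 2: "(\<lambda>T. ?p T * real T * (real T - 1)) sums \<mu>\<^sup>2"
  proof -
    have "(\<lambda>T. ?p (Suc T) * real (Suc T) * (real (Suc T) - 1)) = (\<lambda>T. \<mu> * (?p T * real T))"
      by (simp add: fun_eq_iff divide_simps)
    with sums_mult[OF 1, of \<mu>]
    have "(\<lambda>T. ?p (Suc T) * real (Suc T) * (real (Suc T) - 1)) sums \<mu>\<^sup>2" by (simp add: power2_eq_square)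
    then show ?thesis by (subst (asm) sums_Suc_iff) simp
  qed
  have "(\<lambda>T. ?p T * real T * (real T - 1) + (1 - 2 * \<mu>) * (?p T * real T) + \<mu>\<^sup>2 * ?p T)
     sums (\<mu>\<^sup>2 + (1 - 2 * \<mu>) * \<mu> + \<mu>\<^sup>2 * 1)"
    by (intro sums_add sums_mult p 1 2)
  also have "\<mu>\<^sup>2 + (1 - 2 * \<mu>) * \<mu> + \<mu>\<^sup>2 * 1 = \<mu>" by (simp add: power2_eq_square algebra_simps)
  also have "(\<lambda>T. ?p T * real T * (real T - 1) + (1 - 2 * \<mu>) * (?p T * real T) + \<mu>\<^sup>2 * ?p T) =
      (\<lambda>T. ?p T * (real T - \<mu>)\<^sup>2)"
    by (rule ext) algebra
  finally show "(\<lambda>T. ?p T * (real T - \<mu>)\<^sup>2) sums \<mu>" .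
qed

context
  fixes Q :: "nat \<Rightarrow> real" and \<mu> G :: real
  assumes mono: "mono Q" and range: "\<And>T. 0 \<le> Q T" "\<And>T. Q T \<le> 1"
    and mu: "0 \<le> \<mu>"
    and avg: "(\<lambda>T. exp (- \<mu>) * \<mu> ^ T / fact T * Q T) sums G"
begin

text \<open>
  Chebyshev's inequality is used pointwise: \<open>Q T\<close> differs from \<open>Q S\<close> in the unfavourable direction
  only for \<open>T\<close> beyond \<open>S\<close>, where \<open>(T - \<mu>)\<^sup>2 / (S - \<mu>)\<^sup>2 \<ge> 1\<close>.
\<close>

lemma poisson_average_lower:
  assumes "\<mu> < real S"
  shows "G - \<mu> / (real S - \<mu>)\<^sup>2 \<le> Q S"
proof -
  let ?p = "\<lambda>T. exp (- \<mu>) * \<mu> ^ T / fact T"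
  have "G \<le> Q S * 1 + \<mu> / (real S - \<mu>)\<^sup>2"
  proof (rule sums_le)
    show "(\<lambda>T. ?p T * Q T) sums G" by (rule avg)
    show "(\<lambda>T. Q S * ?p T + ?p T * (real T - \<mu>)\<^sup>2 / (real S - \<mu>)\<^sup>2) sums (Q S * 1 + \<mu> / (real S - \<mu>)\<^sup>2)"
      by (intro sums_add sums_mult sums_divide sums_poisson_variance)
    fix T
    have "Q T \<le> Q S + (real T - \<mu>)\<^sup>2 / (real S - \<mu>)\<^sup>2"
    proof (cases "T \<le> S")
      case True
      then show ?thesis using monoD[OF mono True] by (simp add: add_increasing2)
    next
      case False
      then have "(real S - \<mu>)\<^sup>2 \<le> (real T - \<mu>)\<^sup>2" using assms by (intro power_mono) auto
      then have "1 \<le> (real T - \<mu>)\<^sup>2 / (real S - \<mu>)\<^sup>2" using assms by simp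
      then show ?thesis using range(1)[of S] range(2)[of T] by linarith
    qed
    then have "?p T * Q T \<le> ?p T * (Q S + (real T - \<mu>)\<^sup>2 / (real S - \<mu>)\<^sup>2)"
      using mu by (intro mult_left_mono) auto
    then show "?p T * Q T \<le> Q S * ?p T + ?p T * (real T - \<mu>)\<^sup>2 / (real S - \<mu>)\<^sup>2"
      by (simp add: algebra_simps)
  qed
  then show ?thesis by simp
qed

lemma poisson_average_upper:
  assumes "real S < \<mu>"
  shows "Q S \<le> G + \<mu> / (\<mu> - real S)\<^sup>2"
proof -
  let ?p = "\<lambda>T. exp (- \<mu>) * \<mu> ^ T / fact T"
  have "Q S * 1 - \<mu> / (\<mu> - real S)\<^sup>2 \<le> G"
  proof (rule sums_le)
    show "(\<lambda>T. ?p T * Q T) sums G" by (rule avg)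
    show "(\<lambda>T. Q S * ?p T - ?p T * (real T - \<mu>)\<^sup>2 / (\<mu> - real S)\<^sup>2) sums (Q S * 1 - \<mu> / (\<mu> - real S)\<^sup>2)"
      by (intro sums_diff sums_mult sums_divide sums_poisson_variance)
    fix T
    have "Q S - (real T - \<mu>)\<^sup>2 / (\<mu> - real S)\<^sup>2 \<le> Q T"
    proof (cases "S \<le> T")
      case True
      then show ?thesis using monoD[OF mono True] by (smt (verit) divide_nonneg_nonneg zero_le_power2)
    next
      case False
      then have "(\<mu> - real S)\<^sup>2 \<le> (\<mu> - real T)\<^sup>2" using assms by (intro power_mono) auto
      then have "1 \<le> (real T - \<mu>)\<^sup>2 / (\<mu> - real S)\<^sup>2" using assms by (simp add: power2_commute)
      then show ?thesis using range(2)[of S] range(1)[of T] by linarith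
    qed
    then have "?p T * (Q S - (real T - \<mu>)\<^sup>2 / (\<mu> - real S)\<^sup>2) \<le> ?p T * Q T"
      using mu by (intro mult_left_mono) auto
    then show "Q S * ?p T - ?p T * (real T - \<mu>)\<^sup>2 / (\<mu> - real S)\<^sup>2 \<le> ?p T * Q T"
      by (simp add: algebra_simps)
  qed
  then show ?thesis by simp
qed

end


subsection \<open>Stirling's formula\<close>

text \<open>The logarithm of \<open>n!\<close> divided by
  \<open>n powr (n + 1/2) * exp (- n)\<close> for positive \<open>n\<close>; Stirling's formula says
  that it tends to \<open>ln (sqrt (2 * pi))\<close>.\<close>

definition stirling_defect :: "nat \<Rightarrow> real" where
  "stirling_defect n = ln (fact n) - (real n + 1/2) * ln (real n) + real n"

text \<open>The increments are \<open>O(1 / n^2)\<close>, hence summable. This yields a limit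
  without its value, which Wallis' product supplies later.\<close>

lemma convergent_stirling_defect: "convergent stirling_defect"
proof -
  define d where "d n = stirling_defect (Suc n) - stirling_defect n" for n
  have ev: "\<forall>\<^sub>F n in sequentially. 1 - (real n + 1/2) * (ln (real n + 1) - ln (real n)) = d n"
    using eventually_gt_at_top[of 0]
  proof eventually_elim
    case (elim n)
    have "ln (fact (Suc n)) = ln (1 + real n) + ln (fact n :: real)"
      by (simp only: fact_Suc of_nat_mult of_nat_fact of_nat_Suc) (simp add: ln_mult_pos)
    with elim show ?case
      by (simp add: d_def stirling_defect_def algebra_simps del: fact_Suc)
  qed
  have "(\<lambda>n. 1 - (real n + 1/2) * (ln (real n + 1) - ln (real n))) \<in> O(\<lambda>n. 1 / real n ^ 2)"
    by real_asymp
  also have "?this \<longleftrightarrow> d \<in> O(\<lambda>n. 1 / real n ^ 2)"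
    by (intro landau_o.big.in_cong ev)
  finally have "d \<in> O(\<lambda>n. 1 / real n ^ 2)" .
  have "summable (\<lambda>n. norm (1 / real n ^ 2))"
    using inverse_power_summable[of 2, where 'a = real] by (simp add: divide_inverse)
  then have "summable d" using \<open>d \<in> _\<close> by (rule summable_comparison_test_bigo)
  then have "convergent (\<lambda>n. \<Sum>k<n. d k)" by (simp add: summable_iff_convergent)
  then have "convergent (\<lambda>n. (\<Sum>k<n. d k) + stirling_defect 0)"
    by (intro convergent_add convergent_const)
  moreover have "(\<Sum>k<n. d k) + stirling_defect 0 = stirling_defect n" for n
    unfolding d_def by (subst sum_lessThan_telescope) simp
  ultimately show ?thesis by simp
qed

text \<open>Expressing Wallis' product through \<open>fact n\<close> and \<open>fact (2 * n)\<close>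
  lets its logarithm be compared with Stirling defects.\<close>

lemma wallis_prod_eq:
  "(\<Prod>k=1..n. (4 * real k ^ 2) / (4 * real k ^ 2 - 1)) =
    2 ^ (4 * n) * fact n ^ 4 / (fact (2 * n) ^ 2 * (2 * real n + 1))"
proof (induction n)
  case (Suc n)
  define u v w where "u = real n + 1" and "v = 2 * real n + 1" and "w = 2 * real n + 3"
  have pos: "u > 0" "v > 0" "w > 0" by (simp_all add: u_def v_def w_def add_pos_pos add_nonneg_pos)
  have eqs: "4 * real (Suc n) ^ 2 - 1 = v * w" "4 * real (Suc n) ^ 2 = 4 * u ^ 2"
      "2 * real (Suc n) + 1 = w" "fact (Suc n) = u * fact n"
      "fact (2 * Suc n) = 2 * u * v * fact (2 * n)" "2 ^ (4 * Suc n) = 16 * (2::real) ^ (4 * n)"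
    by (simp_all add: u_def v_def w_def power2_eq_square algebra_simps power_add)
  have "(\<Prod>k=1..Suc n. (4 * real k ^ 2) / (4 * real k ^ 2 - 1)) =
      2 ^ (4 * n) * fact n ^ 4 / (fact (2 * n) ^ 2 * v) * ((4 * u ^ 2) / (v * w))"
    unfolding prod.nat_ivl_Suc'[of 1 n, simplified] using Suc.IH eqs(1,2) by (simp add: v_def mult_ac)
  also have "\<dots> = 16 * 2 ^ (4 * n) * (u * fact n) ^ 4 / ((2 * u * v * fact (2 * n)) ^ 2 * w)"
    using pos by (simp add: field_simps power2_eq_square power4_eq_xxxx)
  finally show ?case unfolding eqs(3-6) .
qed simp

lemma stirling_defect_tendsto: "stirling_defect \<longlonglongrightarrow> ln (2 * pi) / 2"
proof -
  obtain s where s: "stirling_defect \<longlonglongrightarrow> s"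
    using convergent_stirling_defect by (auto simp: convergent_def)
  define W where "W n = (\<Prod>k=1..n. (4 * real k ^ 2) / (4 * real k ^ 2 - 1))" for n
  have "(\<lambda>n. ln (W n)) \<longlonglongrightarrow> ln (pi / 2)"
    unfolding W_def by (intro tendsto_ln wallis) simp
  \<comment> \<open>The correction turns \<open>ln (W n)\<close> into
    \<open>4 * stirling_defect n - 2 * stirling_defect (2 * n)\<close>; the weights 4 and 2 are the
    exponents of the factorials in \<open>wallis_prod_eq\<close>. If the defect tends to
    \<open>s\<close>, this combination tends to \<open>2 * s\<close>, which determines
    \<open>s\<close>.\<close>
  moreover have "(\<lambda>n. ln (2 * real n + 1) - ln (real n) + ln 2) \<longlonglongrightarrow> 2 * ln 2"
    by real_asymp
  ultimately have "(\<lambda>n. ln (W n) + (ln (2 * real n + 1) - ln (real n) + ln 2)) \<longlonglongrightarrow> ln (pi / 2) + 2 * ln 2"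
    by (rule tendsto_add)
  moreover have "\<forall>\<^sub>F n in sequentially. ln (W n) + (ln (2 * real n + 1) - ln (real n) + ln 2) =
      4 * stirling_defect n - 2 * stirling_defect (2 * n)"
    using eventually_gt_at_top[of 0]
  proof eventually_elim
    case (elim n)
    have "ln (W n) = 4 * n * ln 2 + 4 * ln (fact n) - (2 * ln (fact (2 * n)) + ln (2 * real n + 1))"
    proof -
      have "2 * real n + 1 > 0" by linarith
      then show ?thesis
        unfolding W_def wallis_prod_eq
        by (simp add: ln_divide_pos ln_mult_pos ln_realpow)
    qed
    moreover have "ln (real (2 * n)) = ln 2 + ln (real n)" using elim by (simp add: ln_mult)
    ultimately show ?case unfolding stirling_defect_def by (simp add: algebra_simps)
  qed
  ultimately have "(\<lambda>n. 4 * stirling_defect n - 2 * stirling_defect (2 * n)) \<longlonglongrightarrow> ln (pi / 2) + 2 * ln 2"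
    by (simp cong: tendsto_cong)
  moreover have "(\<lambda>n. stirling_defect (2 * n)) \<longlonglongrightarrow> s"
    by (rule filterlim_compose[OF s]) real_asymp
  then have "(\<lambda>n. 4 * stirling_defect n - 2 * stirling_defect (2 * n)) \<longlonglongrightarrow> 4 * s - 2 * s"
    by (intro tendsto_intros s)
  ultimately have "ln (pi / 2) + 2 * ln 2 = 4 * s - 2 * s" by (rule LIMSEQ_unique)
  then have "s = ln (2 * pi) / 2" by (simp add: ln_div ln_mult)
  with s show ?thesis by simp
qed

lemma stirling: "(\<lambda>n. fact n / (sqrt (2 * pi * real n) * (real n / exp 1) ^ n)) \<longlonglongrightarrow> 1"
proof -
  have "(\<lambda>n. exp (stirling_defect n - ln (2 * pi) / 2)) \<longlonglongrightarrow> exp (ln (2 * pi) / 2 - ln (2 * pi) / 2)"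
    by (intro tendsto_intros stirling_defect_tendsto)
  moreover have "\<forall>\<^sub>F n in sequentially. exp (stirling_defect n - ln (2 * pi) / 2) =
      fact n / (sqrt (2 * pi * real n) * (real n / exp 1) ^ n)"
    using eventually_gt_at_top[of 0]
  proof eventually_elim
    case (elim n)
    have "ln (fact n / (sqrt (2 * pi * real n) * (real n / exp 1) ^ n)) = stirling_defect n - ln (2 * pi) / 2"
      using elim by (simp add: stirling_defect_def ln_div ln_mult ln_sqrt ln_realpow algebra_simps add_divide_distrib)
    moreover have "fact n / (sqrt (2 * pi * real n) * (real n / exp 1) ^ n) > (0::real)"
      using elim by simp
    ultimately show ?case by (metis exp_ln)
  qed
  ultimately show ?thesis by (auto dest: Lim_transform_eventually)
qed

text \<open>Taking logarithms, \<open>ln (1 - x)\<close> differs from \<open>- x\<close> by at most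
  \<open>2 * x^2\<close> for small \<open>x\<close>, and \<open>n * x^2 = (n * x) * x\<close> tends
  to 0.\<close>

lemma one_minus_div_power_tendsto:
  fixes x :: "nat \<Rightarrow> real"
  assumes x: "(\<lambda>n. real n * x n) \<longlonglongrightarrow> c"
  shows "(\<lambda>n. (1 - x n) ^ n) \<longlonglongrightarrow> exp (- c)"
proof -
  have x0: "x \<longlonglongrightarrow> 0"
  proof -
    have "(\<lambda>n. real n * x n * (1 / real n)) \<longlonglongrightarrow> c * 0"
      by (intro tendsto_mult x) real_asymp
    moreover have "\<forall>\<^sub>F n in sequentially. real n * x n * (1 / real n) = x n"
      using eventually_gt_at_top[of 0] by eventually_elim simp
    ultimately show ?thesis by (auto dest: Lim_transform_eventually)
  qed
  have small: "\<forall>\<^sub>F n in sequentially. \<bar>x n\<bar> < 1/2"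
    using tendstoD[OF x0, of "1/2"] by simp
  have "(\<lambda>n. real n * x n * (2 * x n)) \<longlonglongrightarrow> c * (2 * 0)"
    by (intro tendsto_intros x x0)
  then have "(\<lambda>n. \<bar>real n * x n * (2 * x n)\<bar>) \<longlonglongrightarrow> 0"
    by (simp add: tendsto_rabs_zero)
  then have "(\<lambda>n. real n * ln (1 - x n) + real n * x n) \<longlonglongrightarrow> 0"
  proof (rule Lim_null_comparison[rotated])
    show "\<forall>\<^sub>F n in sequentially. norm (real n * ln (1 - x n) + real n * x n) \<le> \<bar>real n * x n * (2 * x n)\<bar>"
      using small
    proof eventually_elim
      case (elim n)
      have "\<bar>ln (1 + - x n) - (- x n)\<bar> \<le> 2 * (- x n)\<^sup>2"
        using elim by (intro abs_ln_one_plus_x_minus_x_bound) auto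
      then have "real n * \<bar>ln (1 - x n) + x n\<bar> \<le> real n * (2 * (x n)\<^sup>2)"
        by (intro mult_left_mono) auto
      then show ?case
        by (simp add: power2_eq_square abs_mult distrib_left[symmetric] mult_ac)
    qed
  qed
  from tendsto_diff[OF this x] have "(\<lambda>n. real n * ln (1 - x n)) \<longlonglongrightarrow> - c" by simp
  then have "(\<lambda>n. exp (real n * ln (1 - x n))) \<longlonglongrightarrow> exp (- c)" by (rule tendsto_exp)
  moreover have "\<forall>\<^sub>F n in sequentially. exp (real n * ln (1 - x n)) = (1 - x n) ^ n"
    using small by eventually_elim (simp add: exp_of_nat_mult abs_if split: if_splits)
  ultimately show ?thesis by (simp cong: tendsto_cong)
qed

subsection \<open>Poisson tails as nearly geometric sums\<close>

text \<open>The mass at \<open>m\<close> is factored out and the terms are counted downwards from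
  it, \<open>k = m - i\<close>. The quotients are falling factorials over powers of
  \<open>x\<close>, which can be compared with geometric series.\<close>

lemma poisson_below_eq:
  assumes "x > 0"
  shows "poisson_below m x = exp (- x) * x ^ m / fact m * (\<Sum>i=1..m. (\<Prod>j<i. real (m - j)) / x ^ i)"
proof -
  have "poisson_below m x = (\<Sum>i=1..m. exp (- x) * x ^ (m - i) / fact (m - i))"
    unfolding poisson_below_def
    by (rule sum.reindex_bij_witness[of _ "\<lambda>i. m - i" "\<lambda>k. m - k"]) auto
  also have "\<dots> = (\<Sum>i=1..m. exp (- x) * x ^ m / fact m * ((\<Prod>j<i. real (m - j)) / x ^ i))"
  proof (rule sum.cong)
    fix i assume "i \<in> {1..m}"
    then have i: "i \<le> m" by simp
    then have "fact m = fact (m - i) * (\<Prod>j<i. real (m - j))"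
    proof (induction i)
      case (Suc i)
      have "fact (m - i) = real (m - i) * fact (m - Suc i)"
        using Suc.prems by (metis Suc_diff_Suc Suc_le_lessD fact_Suc of_nat_id of_nat_fact of_nat_mult)
      with Suc show ?case by simp
    qed simp
    moreover have "x ^ m = x ^ (m - i) * x ^ i" using i by (simp flip: power_add)
    moreover have "(\<Prod>j<i. real (m - j)) \<noteq> 0" using i by simp
    ultimately show "exp (- x) * x ^ (m - i) / fact (m - i) =
        exp (- x) * x ^ m / fact m * ((\<Prod>j<i. real (m - j)) / x ^ i)"
      using assms by simp
  qed simp
  finally show ?thesis by (simp add: sum_distrib_left)
qed

lemma geometric_sum_le:
  fixes r :: real
  assumes "0 \<le> r" "r < 1"
  shows "(\<Sum>i<m. r ^ i) \<le> 1 / (1 - r)"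
  using assms by (simp add: sum_gp_strict divide_right_mono)

text \<open>Every factor \<open>m - j\<close> is at most \<open>m\<close>, so a geometric series
  with ratio \<open>m / x < 1\<close> dominates.\<close>

lemma falling_ratio_sum_le:
  assumes "real m < x"
  shows "(\<Sum>i=1..m. (\<Prod>j<i. real (m - j)) / x ^ i) \<le> real m / (x - real m)"
proof -
  let ?r = "real m / x"
  have r: "0 \<le> ?r" "?r < 1" using assms by auto
  have "(\<Sum>i=1..m. (\<Prod>j<i. real (m - j)) / x ^ i) \<le> (\<Sum>i=1..m. ?r ^ i)"
  proof (rule sum_mono)
    fix i
    have "(\<Prod>j<i. real (m - j)) \<le> (\<Prod>j<i. real m)" by (intro prod_mono) auto
    then show "(\<Prod>j<i. real (m - j)) / x ^ i \<le> ?r ^ i"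
      using assms by (simp add: power_divide divide_right_mono)
  qed
  also have "\<dots> = (\<Sum>i<m. ?r * ?r ^ i)"
    by (rule sum.reindex_bij_witness[of _ Suc "\<lambda>k. k - 1"]) (auto simp flip: power_Suc)
  also have "\<dots> \<le> ?r * (1 / (1 - ?r))"
    unfolding sum_distrib_left[symmetric] by (intro mult_left_mono geometric_sum_le r)
  also have "\<dots> = real m / (x - real m)" using assms by (subst eq_divide_eq) (auto simp: field_simps)
  finally show ?thesis .
qed

text \<open>Only the first \<open>J\<close> terms are kept; their factors are at least
  \<open>m - J\<close>, which gives a geometric sum with ratio \<open>r\<close>. The exponential
  bounds \<open>r ^ J\<close>, the loss from truncation. \<open>J\<close> stays free so that this
  loss can be balanced against the change of ratio.\<close>

lemma falling_ratio_sum_ge: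
  assumes "real m < x" "J \<le> m"
  defines "r \<equiv> (real m - real J) / x"
  shows "(real m - real J) / (x - real m + real J) * (1 - exp (- real J * (1 - r)))
    \<le> (\<Sum>i=1..m. (\<Prod>j<i. real (m - j)) / x ^ i)"
proof -
  have r: "0 \<le> r" "r < 1" using assms(1,2) by (auto simp: r_def)
  have "r ^ J \<le> exp (- (1 - r)) ^ J"
    using exp_ge_add_one_self[of "- (1 - r)"] r by (intro power_mono) auto
  then have rJ: "r ^ J \<le> exp (- real J * (1 - r))"
    unfolding exp_of_nat_mult[symmetric] by (simp only: mult_minus_left mult_minus_right)
  have "(real m - real J) / (x - real m + real J) * (1 - exp (- real J * (1 - r)))
      = r * ((1 - exp (- real J * (1 - r))) / (1 - r))"
  proof -
    have "x > 0" "x - real m + real J > 0" using assms(1,2) by auto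
    moreover have "1 - r = (x - real m + real J) / x"
      using \<open>x > 0\<close> by (simp add: r_def divide_simps)
    ultimately have "(real m - real J) / (x - real m + real J) = r / (1 - r)"
      by (simp add: r_def)
    then show ?thesis by simp
  qed
  also have "\<dots> \<le> r * ((1 - r ^ J) / (1 - r))"
    using r rJ by (intro mult_left_mono divide_right_mono) auto
  also have "\<dots> = (\<Sum>i<J. r * r ^ i)" 
    unfolding sum_distrib_left[symmetric] using r by (simp add: sum_gp_strict)
  also have "\<dots> = (\<Sum>i=1..J. r ^ i)"
    by (rule sum.reindex_bij_witness[of _ "\<lambda>k. k - 1" Suc]) (auto simp flip: power_Suc)
  also have "\<dots> \<le> (\<Sum>i=1..J. (\<Prod>j<i. real (m - j)) / x ^ i)"
  proof (rule sum_mono)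
    fix i assume i: "i \<in> {1..J}"
    have "(\<Prod>j<i. real m - real J) \<le> (\<Prod>j<i. real (m - j))"
      using i assms(2) by (intro prod_mono) (auto simp: of_nat_diff)
    then show "r ^ i \<le> (\<Prod>j<i. real (m - j)) / x ^ i"
      using assms(1) by (simp add: r_def power_divide divide_right_mono)
  qed
  also have "\<dots> \<le> (\<Sum>i=1..m. (\<Prod>j<i. real (m - j)) / x ^ i)"
    using assms(1,2) by (intro sum_mono2) (auto intro!: divide_nonneg_nonneg prod_nonneg)
  finally show ?thesis .
qed


subsection \<open>Moderate deviations of the Poisson distribution\<close>

context
  fixes m :: "nat \<Rightarrow> nat" and a :: "nat \<Rightarrow> real"
  assumes m_top: "filterlim m at_top sequentially"
    and a_top: "filterlim a at_top sequentially"
    and a_cube: "(\<lambda>n. a n ^ 3 / sqrt (real (m n))) \<longlonglongrightarrow> 0"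
begin

lemma sqrt_m_top: "filterlim (\<lambda>n. sqrt (real (m n))) at_top sequentially"
  by (rule filterlim_compose[OF sqrt_at_top filterlim_compose[OF filterlim_real_sequentially m_top]])

lemma eventually_m_a_pos: "\<forall>\<^sub>F n in sequentially. m n > 0 \<and> a n > 0"
proof (rule eventually_conj)
  show "\<forall>\<^sub>F n in sequentially. m n > 0"
    using m_top eventually_gt_at_top[of 0] by (rule eventually_compose_filterlim[rotated])
  show "\<forall>\<^sub>F n in sequentially. a n > 0" using a_top by (simp add: filterlim_at_top_dense)
qed

lemma a_over_sqrt_m: "(\<lambda>n. a n / sqrt (real (m n))) \<longlonglongrightarrow> 0"
proof (rule Lim_null_comparison[OF _ a_cube])
  have "\<forall>\<^sub>F n in sequentially. a n \<ge> 1" using a_top by (simp add: filterlim_at_top)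
  then show "\<forall>\<^sub>F n in sequentially. norm (a n / sqrt (real (m n))) \<le> a n ^ 3 / sqrt (real (m n))"
  proof eventually_elim
    case (elim n)
    then have "a n ^ 1 \<le> a n ^ 3" by (intro power_increasing) auto
    with elim show ?case by (simp add: divide_right_mono)
  qed
qed

text \<open>The sum is asymptotic to \<open>sqrt m / a\<close>: the upper geometric bound equals
  this value exactly, and the lower one approaches it for a suitable cutoff.\<close>

lemma falling_ratio_sum_asymp:
  "(\<lambda>n. (\<Sum>i=1..m n. (\<Prod>j<i. real (m n - j)) / (real (m n) + sqrt (real (m n)) * a n) ^ i)
      * (a n / sqrt (real (m n)))) \<longlonglongrightarrow> 1" (is "?S \<longlonglongrightarrow> 1")
proof (rule tendsto_sandwich)
  define s where "s n = sqrt (real (m n))" for n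
  \<comment> \<open>Cutting the sum at \<open>\<lfloor>\<surd>m\<rfloor>\<close> keeps all but a fraction \<open>exp (- a)\<close> of the geometric series with
    ratio \<open>1 - a / \<surd>m\<close>, yet changes that ratio only by a factor \<open>1 + o(1)\<close> in \<open>a / \<surd>m\<close>.\<close>
  define J where "J n = nat \<lfloor>s n\<rfloor>" for n
  define q where "q n = real (J n) / s n" for n
  \<comment> \<open>This is the bound of \<open>falling_ratio_sum_ge\<close> times
    \<open>a / s\<close>, simplified by \<open>m = s * s\<close> and \<open>J = s * q\<close>. Its
    limit follows from \<open>q\<close> tending to 1 while \<open>s\<close> and \<open>a\<close>
    tend to infinity.\<close>
  define l where "l n = (1 - q n / s n) / (1 + q n / a n) *
      (1 - exp (- (q n * (a n + q n) / (1 + a n / s n))))" for n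
  have s_top: "filterlim s at_top sequentially" unfolding s_def by (rule sqrt_m_top)
  have x0: "(\<lambda>n. a n / s n) \<longlonglongrightarrow> 0" unfolding s_def by (rule a_over_sqrt_m)
  have q1: "q \<longlonglongrightarrow> 1"
  proof -
    have "((\<lambda>s::real. real (nat \<lfloor>s\<rfloor>) / s) \<longlongrightarrow> 1) at_top" by real_asymp
    from filterlim_compose[OF this s_top] show ?thesis by (simp add: q_def[abs_def] J_def)
  qed
  have "(\<lambda>n. q n / s n) \<longlonglongrightarrow> 0"
    by (rule real_tendsto_divide_at_top[OF q1 s_top])
  moreover have "(\<lambda>n. q n / a n) \<longlonglongrightarrow> 0"
    by (rule real_tendsto_divide_at_top[OF q1 a_top])
  moreover have "(\<lambda>n. exp (- (q n * (a n + q n) / (1 + a n / s n)))) \<longlonglongrightarrow> 0"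
  proof -
    have "filterlim (\<lambda>n. a n + q n) at_top sequentially"
      using filterlim_tendsto_add_at_top[OF q1 a_top] by (simp add: add.commute)
    moreover have "(\<lambda>n. q n / (1 + a n / s n)) \<longlonglongrightarrow> 1 / (1 + 0)"
      by (intro tendsto_intros q1 x0) simp
    ultimately have "filterlim (\<lambda>n. (q n / (1 + a n / s n)) * (a n + q n)) at_top sequentially"
      using filterlim_tendsto_pos_mult_at_top[of "\<lambda>n. q n / (1 + a n / s n)" 1] by simp
    then have "filterlim (\<lambda>n. q n * (a n + q n) / (1 + a n / s n)) at_top sequentially"
      by simp
    then show ?thesis
      by (intro filterlim_compose[OF exp_at_bot]) (simp add: filterlim_uminus_at_bot)
  qed
  ultimately have "l \<longlonglongrightarrow> (1 - 0) / (1 + 0) * (1 - 0)"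
    unfolding l_def by (intro tendsto_intros) auto
  then show "l \<longlonglongrightarrow> 1" by simp
  show "\<forall>\<^sub>F n in sequentially. l n \<le> ?S n" using eventually_m_a_pos
  proof eventually_elim
    case (elim n)
    let ?x = "real (m n) + s n * a n"
    have s: "s n > 0" "s n * s n = real (m n)" "s n \<ge> 1" using elim by (auto simp: s_def)
    have "real (J n) \<le> s n" using s by (simp add: J_def)
    also have "s n \<le> real (m n)" using mult_left_mono[of 1 "s n" "s n"] s by simp
    finally have J: "J n \<le> m n" by simp
    have "?x > 0" using elim s by (simp add: add_pos_pos)
    have "(real (m n) - real (J n)) / (?x - real (m n) + real (J n)) * (1 - exp (- real (J n) * (1 - (real (m n) - real (J n)) / ?x)))
      \<le> (\<Sum>i=1..m n. (\<Prod>j<i. real (m n - j)) / ?x ^ i)"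
      by (rule falling_ratio_sum_ge) (use J elim s in auto)
    also have "1 - (real (m n) - real (J n)) / ?x = (s n * a n + real (J n)) / ?x"
      using \<open>?x > 0\<close> by (simp add: divide_simps)
    finally have *: "(real (m n) - real (J n)) / (s n * a n + real (J n)) *
        (1 - exp (- (real (J n) * ((s n * a n + real (J n)) / ?x))))
      \<le> (\<Sum>i=1..m n. (\<Prod>j<i. real (m n - j)) / ?x ^ i)" by simp
    have Jq: "real (J n) = s n * q n" using s by (simp add: q_def)
    have f1: "(real (m n) - real (J n)) / (s n * a n + real (J n)) * (a n / s n) = (1 - q n / s n) / (1 + q n / a n)"
    proof -
      have "q n \<ge> 0" using s by (simp add: q_def)
      then have "a n + q n > 0" using elim by (simp add: add_pos_nonneg)
      have "(real (m n) - real (J n)) / (s n * a n + real (J n)) = (s n * (s n - q n)) / (s n * (a n + q n))"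
        unfolding Jq s(2)[symmetric] by (simp add: algebra_simps)
      also have "\<dots> = (s n - q n) / (a n + q n)" using s(1) by simp
      finally have "(real (m n) - real (J n)) / (s n * a n + real (J n)) * (a n / s n) =
          ((s n - q n) / s n) / ((a n + q n) / a n)" by simp
      also have "(s n - q n) / s n = 1 - q n / s n" using s(1) by (simp add: diff_divide_distrib)
      also have "(a n + q n) / a n = 1 + q n / a n" using elim by (simp add: add_divide_distrib)
      finally show ?thesis .
    qed
    have f2: "real (J n) * ((s n * a n + real (J n)) / ?x) = q n * (a n + q n) / (1 + a n / s n)"
    proof -
      have "(s n * a n + s n * q n) / (s n * s n + s n * a n) = (s n * (a n + q n)) / (s n * (s n + a n))"
        by (simp add: algebra_simps)
      also have "\<dots> = (a n + q n) / (s n + a n)" using s(1) by simp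
      finally have "real (J n) * ((s n * a n + real (J n)) / ?x) = q n * (a n + q n) / ((s n + a n) / s n)"
        unfolding Jq s(2)[symmetric] by simp
      also have "(s n + a n) / s n = 1 + a n / s n" using s(1) by (simp add: add_divide_distrib)
      finally show ?thesis .
    qed
    have "l n = (real (m n) - real (J n)) / (s n * a n + real (J n)) *
        (1 - exp (- (real (J n) * ((s n * a n + real (J n)) / ?x)))) * (a n / s n)"
      unfolding l_def f1[symmetric] f2[symmetric] by (simp only: mult_ac)
    also have "\<dots> \<le> (\<Sum>i=1..m n. (\<Prod>j<i. real (m n - j)) / ?x ^ i) * (a n / s n)"
      using elim s by (intro mult_right_mono *) auto
    finally show ?case by (simp add: s_def)
  qed
  show "\<forall>\<^sub>F n in sequentially. ?S n \<le> 1" using eventually_m_a_pos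
  proof eventually_elim
    case (elim n)
    have "(\<Sum>i=1..m n. (\<Prod>j<i. real (m n - j)) / (real (m n) + s n * a n) ^ i) \<le> real (m n) / ((real (m n) + s n * a n) - real (m n))"
      by (rule falling_ratio_sum_le) (use elim in \<open>auto simp: s_def\<close>)
    also have "\<dots> = s n / a n" using elim by (simp add: s_def divide_simps)
    finally have "?S n \<le> (s n / a n) * (a n / s n)"
      unfolding s_def using elim by (intro mult_right_mono) auto
    also have "\<dots> = 1" using elim by (simp add: s_def)
    finally show ?case .
  qed
qed simp

text \<open>With \<open>x = a / sqrt m\<close>, the exponent left after Stirling's formula is
  \<open>m * (ln (1 + x) - x)\<close>, that is \<open>- a^2 / 2\<close> plus
  \<open>a^3 / sqrt m\<close> times the normalized cubic remainder \<open>g x\<close>. As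
  \<open>g\<close> tends to 1/3 at 0, \<open>a_cube\<close> removes the remainder.\<close>

lemma poisson_mass_asymp:
  "(\<lambda>n. exp (- (real (m n) + sqrt (real (m n)) * a n)) * (real (m n) + sqrt (real (m n)) * a n) ^ m n / fact (m n)
     * (sqrt (2 * pi) * sqrt (real (m n)) * exp ((a n)\<^sup>2 / 2))) \<longlonglongrightarrow> 1"
proof -
  define s where "s n = sqrt (real (m n))" for n
  define x where "x n = a n / s n" for n
  define g where "g = (\<lambda>x::real. (ln (1 + x) - x + x\<^sup>2 / 2) / x ^ 3)"
  define st where "st n = fact n / (sqrt (2 * pi * real n) * (real n / exp 1) ^ n)" for n
  have x0: "x \<longlonglongrightarrow> 0" unfolding x_def s_def by (rule a_over_sqrt_m)
  have xpos: "\<forall>\<^sub>F n in sequentially. x n > 0"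
    using eventually_m_a_pos by eventually_elim (simp add: x_def s_def)
  have "(g \<longlongrightarrow> 1 / 3) (at_right 0)" unfolding g_def by real_asymp
  moreover have "filterlim x (at_right 0) sequentially"
    using x0 xpos by (auto simp: filterlim_at elim: eventually_mono)
  ultimately have "(\<lambda>n. g (x n)) \<longlonglongrightarrow> 1 / 3" by (rule filterlim_compose)
  then have "(\<lambda>n. a n ^ 3 / s n * g (x n)) \<longlonglongrightarrow> 0 * (1 / 3)"
    unfolding s_def by (intro tendsto_mult a_cube)
  then have "(\<lambda>n. exp (a n ^ 3 / s n * g (x n))) \<longlonglongrightarrow> exp 0"
    by (intro tendsto_exp) simp
  moreover have "(\<lambda>n. st (m n)) \<longlonglongrightarrow> 1"
    using filterlim_compose[OF stirling m_top] by (simp add: st_def)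
  ultimately have "(\<lambda>n. exp (a n ^ 3 / s n * g (x n)) / st (m n)) \<longlonglongrightarrow> exp 0 / 1"
    by (rule tendsto_divide) simp
  moreover have "\<forall>\<^sub>F n in sequentially. exp (a n ^ 3 / s n * g (x n)) / st (m n) =
      exp (- (real (m n) + s n * a n)) * (real (m n) + s n * a n) ^ m n / fact (m n)
        * (sqrt (2 * pi) * s n * exp ((a n)\<^sup>2 / 2))"
    using eventually_m_a_pos xpos
  proof eventually_elim
    case (elim n)
    have s: "s n > 0" "s n * s n = real (m n)" using elim by (auto simp: s_def)
    have a: "a n = s n * x n" using s by (simp add: x_def)
    have "a n ^ 3 / s n * g (x n) = real (m n) * (ln (1 + x n) - x n + (x n)\<^sup>2 / 2)"
      unfolding g_def a s(2)[symmetric] using s(1) elim by (simp add: field_simps power2_eq_square power3_eq_cube)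
    also have "\<dots> = real (m n) * ln (1 + x n) + (- (s n * a n)) + (a n)\<^sup>2 / 2"
      unfolding a s(2)[symmetric] by (simp add: algebra_simps power2_eq_square)
    finally have "exp (a n ^ 3 / s n * g (x n)) = (1 + x n) ^ m n * exp (- (s n * a n)) * exp ((a n)\<^sup>2 / 2)"
      using elim by (simp only: exp_add exp_of_nat_mult) simp
    moreover have "real (m n) + s n * a n = real (m n) * (1 + x n)"
      unfolding a s(2)[symmetric] by (simp add: algebra_simps)
    then have "(real (m n) + s n * a n) ^ m n = real (m n) ^ m n * (1 + x n) ^ m n"
      by (simp add: power_mult_distrib)
    moreover have "exp (1::real) ^ m n = exp (real (m n))" by (simp add: exp_of_nat_mult[symmetric])
    moreover have "exp (- (real (m n) + s n * a n)) = exp (- (s n * a n)) / exp (real (m n))"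
      by (simp add: exp_add exp_diff exp_minus field_simps)
    moreover have "sqrt (2 * pi * real (m n)) = sqrt (2 * pi) * s n" by (simp add: real_sqrt_mult s_def)
    ultimately show ?case by (simp only: st_def power_divide) (simp add: mult_ac)
  qed
  ultimately show ?thesis by (simp add: s_def Lim_transform_eventually)
qed

text \<open>Multiplying the mass at \<open>m\<close> by the geometric factor
  \<open>sqrt m / a\<close> cancels \<open>sqrt m\<close>. The Poisson lower tail thus matches the
  leading term of the standard normal tail beyond \<open>a\<close>.\<close>

lemma poisson_below_asymp:
  "(\<lambda>n. poisson_below (m n) (real (m n) + sqrt (real (m n)) * a n) * (sqrt (2 * pi) * a n * exp ((a n)\<^sup>2 / 2)))
    \<longlonglongrightarrow> 1"
proof -
  have "\<forall>\<^sub>F n in sequentially.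
      exp (- (real (m n) + sqrt (real (m n)) * a n)) * (real (m n) + sqrt (real (m n)) * a n) ^ m n / fact (m n)
        * (sqrt (2 * pi) * sqrt (real (m n)) * exp ((a n)\<^sup>2 / 2)) *
      ((\<Sum>i=1..m n. (\<Prod>j<i. real (m n - j)) / (real (m n) + sqrt (real (m n)) * a n) ^ i)
        * (a n / sqrt (real (m n)))) =
      poisson_below (m n) (real (m n) + sqrt (real (m n)) * a n) * (sqrt (2 * pi) * a n * exp ((a n)\<^sup>2 / 2))"
    using eventually_m_a_pos
  proof eventually_elim
    case (elim n)
    then have "real (m n) + sqrt (real (m n)) * a n > 0" by (intro add_pos_pos mult_pos_pos) auto
    from poisson_below_eq[OF this] elim show ?case by (simp add: field_simps)
  qed
  with tendsto_mult[OF poisson_mass_asymp falling_ratio_sum_asymp] show ?thesis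
    by (auto dest: Lim_transform_eventually)
qed

end

section \<open>Gumbel thresholds and the limit under Poissonization\<close>

definition threshold :: "nat \<Rightarrow> real \<Rightarrow> real" where
  "threshold n y = sqrt (2 * ln (real n) - ln (ln (real n))) + y / sqrt (2 * ln (real n))"

context
  fixes y :: "nat \<Rightarrow> real" and c :: real
  assumes y: "y \<longlonglongrightarrow> c"
begin

text \<open>\<open>n * (m + sqrt m * threshold n y)\<close> is the time at which the normalized
  detection time of the first limit equals \<open>y\<close>. The parameter is a convergent sequence
  because both de-Poissonization and the second normalization shift it by an amount depending on
  \<open>n\<close>.\<close>

lemma threshold_over_sqrt_ln: "(\<lambda>n. threshold n (y n) / sqrt (ln (real n))) \<longlonglongrightarrow> sqrt 2"
proof -
  have "(\<lambda>n. sqrt (2 * ln (real n) - ln (ln (real n))) / sqrt (ln (real n))) \<longlonglongrightarrow> 2 powr (1 / 2)"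
    by real_asymp
  moreover have "(\<lambda>n. 1 / (sqrt (2 * ln (real n)) * sqrt (ln (real n)))) \<longlonglongrightarrow> 0"
    by real_asymp
  ultimately have "(\<lambda>n. sqrt (2 * ln (real n) - ln (ln (real n))) / sqrt (ln (real n)) +
      y n * (1 / (sqrt (2 * ln (real n)) * sqrt (ln (real n))))) \<longlonglongrightarrow> 2 powr (1 / 2) + c * 0"
    by (intro tendsto_intros y)
  then show ?thesis by (simp add: threshold_def add_divide_distrib powr_half_sqrt)
qed

lemma threshold_at_top: "filterlim (\<lambda>n. threshold n (y n)) at_top sequentially"
proof -
  have "filterlim (\<lambda>n. sqrt (ln (real n))) at_top sequentially" by real_asymp
  from filterlim_tendsto_pos_mult_at_top[OF threshold_over_sqrt_ln _ this]
  have "filterlim (\<lambda>n. threshold n (y n) / sqrt (ln (real n)) * sqrt (ln (real n))) at_top sequentially"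
    by simp
  moreover have "\<forall>\<^sub>F n in sequentially. threshold n (y n) / sqrt (ln (real n)) * sqrt (ln (real n)) = threshold n (y n)"
    using eventually_gt_at_top[of 1] by eventually_elim simp
  ultimately show ?thesis by (rule filterlim_cong[OF refl refl, THEN iffD1, rotated])
qed

text \<open>Squaring the threshold gives \<open>a^2 / 2 = ln n - ln (ln n) / 2 + d n\<close>, where
  \<open>d n\<close> collects the cross term and the square of the \<open>y\<close> part and tends
  to \<open>c\<close>. The resulting factor \<open>sqrt (ln n)\<close> cancels against
  \<open>a\<close>, which is asymptotic to \<open>sqrt (2 * ln n)\<close>.\<close>

lemma threshold_gauss_tail:
  "(\<lambda>n. real n / (sqrt (2 * pi) * threshold n (y n) * exp ((threshold n (y n))\<^sup>2 / 2)))
     \<longlonglongrightarrow> exp (- c) / (2 * sqrt pi)"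
proof -
  let ?a = "\<lambda>n. threshold n (y n)"
  define d where "d n = y n * (sqrt (2 * ln (real n) - ln (ln (real n))) / sqrt (2 * ln (real n)))
      + (y n)\<^sup>2 * (1 / (4 * ln (real n)))" for n
  have "(\<lambda>n. sqrt (2 * ln (real n) - ln (ln (real n))) / sqrt (2 * ln (real n))) \<longlonglongrightarrow> 1"
    by real_asymp
  moreover have "(\<lambda>n. 1 / (4 * ln (real n))) \<longlonglongrightarrow> 0" by real_asymp
  ultimately have "d \<longlonglongrightarrow> c * 1 + c\<^sup>2 * 0" unfolding d_def by (intro tendsto_intros y)
  then have "(\<lambda>n. exp (- d n) / (?a n / sqrt (ln (real n)) * sqrt (2 * pi))) \<longlonglongrightarrow> exp (- c) / (sqrt 2 * sqrt (2 * pi))"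
    by (intro tendsto_intros threshold_over_sqrt_ln) auto
  moreover have "sqrt 2 * sqrt (2 * pi) = 2 * sqrt pi" by (simp add: real_sqrt_mult)
  moreover have "\<forall>\<^sub>F n in sequentially. exp (- d n) / (?a n / sqrt (ln (real n)) * sqrt (2 * pi)) =
      real n / (sqrt (2 * pi) * ?a n * exp ((?a n)\<^sup>2 / 2))"
  proof -
    have "\<forall>\<^sub>F n in sequentially. 2 * ln (real n) - ln (ln (real n)) > 0" by real_asymp
    then show ?thesis using eventually_gt_at_top[of 1]
    proof eventually_elim
      case (elim n)
      define L where "L = ln (real n)"
      have L: "L > 0" "2 * L - ln L > 0" using elim by (auto simp: L_def)
      have "(?a n)\<^sup>2 / 2 = (sqrt (2 * L - ln L))\<^sup>2 / 2 + y n * (sqrt (2 * L - ln L) / sqrt (2 * L))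
          + (y n)\<^sup>2 / (2 * (sqrt (2 * L))\<^sup>2)"
        unfolding threshold_def L_def[symmetric] by (simp add: power2_sum power_divide add_divide_distrib mult_ac)
      also have "\<dots> = L + d n - ln (sqrt L)"
        using L unfolding d_def L_def[symmetric] by (simp add: diff_divide_distrib ln_sqrt)
      finally have "exp ((?a n)\<^sup>2 / 2) = exp L * exp (d n) / exp (ln (sqrt L))"
        by (simp only: exp_add exp_diff)
      also have "\<dots> = real n * exp (d n) / sqrt L"
        using L elim by (simp add: L_def)
      finally have E: "exp ((?a n)\<^sup>2 / 2) = real n * exp (d n) / sqrt L" .
      show ?case unfolding L_def[symmetric] E using L elim
        by (simp add: exp_minus field_simps)
    qed
  qed
  ultimately show ?thesis by (simp add: Lim_transform_eventually)
qed

text \<open>As the threshold has order \<open>sqrt (ln n)\<close>, its cube over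
  \<open>sqrt m\<close> has the order of the square root of \<open>(ln n)^3 / m\<close>; here the
  growth assumption on \<open>m\<close> provides \<open>a_cube\<close>.\<close>

lemma threshold_cube:
  assumes m_growth: "(\<lambda>n. (ln (real n)) ^ 3 / real (m n)) \<longlonglongrightarrow> 0"
  shows "(\<lambda>n. threshold n (y n) ^ 3 / sqrt (real (m n))) \<longlonglongrightarrow> 0"
proof -
  let ?a = "\<lambda>n. threshold n (y n)"
  have "(\<lambda>n. (?a n / sqrt (ln (real n))) ^ 3 * sqrt ((ln (real n)) ^ 3 / real (m n))) \<longlonglongrightarrow> sqrt 2 ^ 3 * sqrt 0"
    by (intro tendsto_intros threshold_over_sqrt_ln m_growth)
  moreover have "\<forall>\<^sub>F n in sequentially. (?a n / sqrt (ln (real n))) ^ 3 * sqrt ((ln (real n)) ^ 3 / real (m n))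
      = ?a n ^ 3 / sqrt (real (m n))"
    using eventually_gt_at_top[of 1]
  proof eventually_elim
    case (elim n)
    then show ?case by (simp add: real_sqrt_divide real_sqrt_power power_divide)
  qed
  ultimately show ?thesis
    by (simp add: Lim_transform_eventually)
qed

lemma poissonized_limit:
  fixes m :: "nat \<Rightarrow> nat"
  assumes m_top: "filterlim m at_top sequentially"
    and m_growth: "(\<lambda>n. (ln (real n)) ^ 3 / real (m n)) \<longlonglongrightarrow> 0"
  shows "(\<lambda>n. (1 - poisson_below (m n) (real (m n) + sqrt (real (m n)) * threshold n (y n))) ^ n)
    \<longlonglongrightarrow> exp (- (exp (- c) / (2 * sqrt pi)))"
proof (rule one_minus_div_power_tendsto)
  let ?a = "\<lambda>n. threshold n (y n)"
  let ?L = "\<lambda>n. poisson_below (m n) (real (m n) + sqrt (real (m n)) * ?a n)"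
  have "(\<lambda>n. ?L n * (sqrt (2 * pi) * ?a n * exp ((?a n)\<^sup>2 / 2)) *
     (real n / (sqrt (2 * pi) * ?a n * exp ((?a n)\<^sup>2 / 2)))) \<longlonglongrightarrow> 1 * (exp (- c) / (2 * sqrt pi))"
    by (intro tendsto_mult poisson_below_asymp threshold_gauss_tail m_top threshold_at_top threshold_cube m_growth)
  moreover have "\<forall>\<^sub>F n in sequentially. ?a n > 0"
    using threshold_at_top by (simp add: filterlim_at_top_dense)
  then have "\<forall>\<^sub>F n in sequentially. ?L n * (sqrt (2 * pi) * ?a n * exp ((?a n)\<^sup>2 / 2)) *
     (real n / (sqrt (2 * pi) * ?a n * exp ((?a n)\<^sup>2 / 2))) = real n * ?L n"
    by eventually_elim simp
  ultimately show "(\<lambda>n. real n * ?L n) \<longlonglongrightarrow> exp (- c) / (2 * sqrt pi)"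
    by (simp add: Lim_transform_eventually)
qed

end


lemma poisson_below_at_top: "((\<lambda>x. poisson_below m x) \<longlongrightarrow> 0) at_top"
proof -
  have "((\<lambda>x::real. \<Sum>k<m. x ^ k / exp x / fact k) \<longlongrightarrow> (\<Sum>k<m. 0 / fact k)) at_top"
    by (intro tendsto_sum tendsto_divide tendsto_power_div_exp_0 tendsto_const) simp
  then show ?thesis by (simp add: poisson_below_def[abs_def] exp_minus field_simps)
qed

subsection \<open>De-Poissonization\<close>

context coupon_collector
begin

lemma X_measurable: "X t \<in> measurable M (count_space {1..n})"
  using indep_trials unfolding indep_vars_def by blast

lemma X_range: "\<omega> \<in> space M \<Longrightarrow> X t \<omega> \<in> {1..n}"
  using measurable_space[OF X_measurable] by auto

lemma n_pos: "n \<ge> 1"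
proof -
  obtain \<omega> where "\<omega> \<in> space M" using not_empty by blast
  from X_range[OF this] show ?thesis by (metis atLeastAtMost_iff le_trans)
qed

lemma X_event [measurable]: "{\<omega> \<in> space M. X t \<omega> = j} \<in> events"
proof -
  have "{\<omega> \<in> space M. X t \<omega> = j} = X t -` ({j} \<inter> {1..n}) \<inter> space M"
    using X_range by auto
  then show ?thesis using measurable_sets[OF X_measurable, of "{j} \<inter> {1..n}" t] by simp
qed

lemma prob_word:
  assumes "f \<in> {..<T} \<rightarrow> {1..n}"
  shows "prob {\<omega> \<in> space M. \<forall>t<T. X t \<omega> = f t} = 1 / real n ^ T"
\<comment> \<open>For the empty word the intersection below would run over no index and be
  \<open>UNIV\<close> instead of \<open>space M\<close>.\<close>
proof (cases "T = 0")
  case True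
  then show ?thesis by (simp add: prob_space)
next
  case False
  have "{\<omega> \<in> space M. \<forall>t<T. X t \<omega> = f t} = (\<Inter>t\<in>{..<T}. X t -` {f t} \<inter> space M)"
    using False by auto
  also have "prob \<dots> = (\<Prod>t\<in>{..<T}. prob (X t -` {f t} \<inter> space M))"
    using False assms by (intro indep_varsD[OF indep_trials]) auto
  also have "\<dots> = (\<Prod>t\<in>{..<T}. 1 / real n)"
  proof (rule prod.cong)
    fix t assume "t \<in> {..<T}"
    then have "f t \<in> {1..n}" using assms by auto
    from uniform_trials[OF this, of t] show "prob (X t -` {f t} \<inter> space M) = 1 / real n"
      by (simp add: vimage_def Int_def conj_commute)
  qed simp
  finally show ?thesis by (simp add: power_one_over)
qed

text \<open>Detection by time \<open>T\<close> stated without \<open>LEAST\<close>: these events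
  increase with \<open>T\<close>, and their probabilities are word counts.\<close>

definition all_detected :: "nat \<Rightarrow> nat \<Rightarrow> 'a set" where
  "all_detected m T = {\<omega> \<in> space M. \<forall>j\<in>{1..n}. m \<le> card {t \<in> {..<T}. X t \<omega> = j}}"

lemma all_detected_events [measurable]: "all_detected m T \<in> events"
  unfolding all_detected_def by measurable

lemma detection_time_measurable: "detection_time m n X \<in> measurable M (count_space UNIV)"
  unfolding detection_time_def by measurable

lemma all_detected_mono: "S \<le> T \<Longrightarrow> all_detected m S \<subseteq> all_detected m T"
proof -
  assume "S \<le> T"
  then have "card {t \<in> {..<S}. X t \<omega> = j} \<le> card {t \<in> {..<T}. X t \<omega> = j}" for \<omega> j
    by (intro card_mono) auto
  then show ?thesis unfolding all_detected_def by (blast intro: order_trans)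
qed

text \<open>The event is the disjoint union, over all full words, of the events that the first
  \<open>T\<close> trials spell that word.\<close>

lemma prob_all_detected:
  "prob (all_detected m T) = real (card (full_words m n {..<T})) / real n ^ T"
proof -
  let ?W = "full_words m n {..<T}"
  define E where "E f = {\<omega> \<in> space M. \<forall>t<T. X t \<omega> = f t}" for f
  have W: "f \<in> {..<T} \<rightarrow> {1..n}" if "f \<in> ?W" for f using that by (auto simp: full_words_def)
  have "all_detected m T = (\<Union>f\<in>?W. E f)"
  proof (intro set_eqI iffI)
    fix \<omega> assume \<omega>: "\<omega> \<in> all_detected m T"
    let ?f = "\<lambda>t\<in>{..<T}. X t \<omega>"
    have "{t \<in> {..<T}. ?f t = j} = {t \<in> {..<T}. X t \<omega> = j}" for j by auto
    moreover have "?f \<in> {..<T} \<rightarrow>\<^sub>E {1..n}"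
      using \<omega> X_range by (simp add: all_detected_def PiE_iff)
    ultimately have "?f \<in> ?W" using \<omega> by (simp add: full_words_def all_detected_def)
    moreover have "\<omega> \<in> E ?f" using \<omega> by (auto simp: E_def all_detected_def)
    ultimately show "\<omega> \<in> (\<Union>f\<in>?W. E f)" by blast
  next
    fix \<omega> assume "\<omega> \<in> (\<Union>f\<in>?W. E f)"
    then obtain f where f: "f \<in> ?W" "\<omega> \<in> E f" by auto
    then have "{t \<in> {..<T}. X t \<omega> = j} = {t \<in> {..<T}. f t = j}" for j by (auto simp: E_def)
    with f show "\<omega> \<in> all_detected m T" by (simp add: full_words_def all_detected_def E_def)
  qed
  moreover have "disjoint_family_on E ?W"
  proof (unfold disjoint_family_on_def, intro ballI impI)
    fix f g assume "f \<in> ?W" "g \<in> ?W" "f \<noteq> g"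
    then have "f \<in> {..<T} \<rightarrow>\<^sub>E {1..n}" "g \<in> {..<T} \<rightarrow>\<^sub>E {1..n}"
      by (simp_all add: full_words_def)
    then obtain t where "t < T" "f t \<noteq> g t"
      using \<open>f \<noteq> g\<close> PiE_ext lessThan_iff by metis
    then show "E f \<inter> E g = {}" by (auto simp: E_def)
  qed
  moreover have "E ` ?W \<subseteq> events" unfolding E_def by auto
  ultimately have "prob (all_detected m T) = (\<Sum>f\<in>?W. prob (E f))"
    by (simp add: finite_measure_finite_Union finite_full_words)
  also have "\<dots> = (\<Sum>f\<in>?W. 1 / real n ^ T)"
    unfolding E_def by (intro sum.cong prob_word W) auto
  finally show ?thesis by simp
qed

lemma poisson_average_all_detected:
  "(\<lambda>T. exp (- \<mu>) * \<mu> ^ T / fact T * prob (all_detected m T)) sums (1 - poisson_below m (\<mu> / real n)) ^ n"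
  unfolding prob_all_detected by (rule sums_poisson_full_words[OF n_pos])

text \<open>The Poisson average never exceeds the probability of the union, whatever the mean. For
  fixed \<open>m\<close> and \<open>n\<close> it tends to 1 as the mean grows, by
  \<open>poisson_below_at_top\<close>.\<close>

lemma AE_detected: "AE \<omega> in M. \<exists>T. \<omega> \<in> all_detected m T"
proof -
  let ?E = "\<Union>T. all_detected m T"
  have "(1 - poisson_below m (\<mu> / real n)) ^ n \<le> prob ?E" if "\<mu> \<ge> 0" for \<mu>
  proof (rule sums_le[OF _ poisson_average_all_detected])
    show "(\<lambda>T. prob ?E * (exp (- \<mu>) * \<mu> ^ T / fact T)) sums prob ?E"
      using sums_mult[OF sums_poisson_variance(1)[of \<mu>], of "prob ?E"] by simp
    show "exp (- \<mu>) * \<mu> ^ T / fact T * prob (all_detected m T) \<le> prob ?E * (exp (- \<mu>) * \<mu> ^ T / fact T)" for T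
      using that by (subst mult.commute, intro mult_right_mono finite_measure_mono) auto
  qed
  then have "\<forall>\<^sub>F \<mu> in at_top. (1 - poisson_below m (\<mu> / real n)) ^ n \<le> prob ?E"
    by (rule eventually_mono[OF eventually_ge_at_top[of 0]])
  moreover have "((\<lambda>\<mu>. (1 - poisson_below m (\<mu> / real n)) ^ n) \<longlongrightarrow> (1 - 0) ^ n) at_top"
  proof -
    have "filterlim (\<lambda>\<mu>. \<mu> / real n) at_top at_top"
      using n_pos by real_asymp
    from filterlim_compose[OF poisson_below_at_top this] show ?thesis
      by (intro tendsto_intros)
  qed
  ultimately have "1 \<le> prob ?E"
    by (intro tendsto_upperbound[where F = at_top]) auto
  then have "prob ?E = 1" using prob_le_1 by (rule antisym[rotated])
  then have "AE \<omega> in M. \<omega> \<in> ?E" by (subst prob_eq_1[symmetric]) auto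
  then show ?thesis by simp
qed

text \<open>Where detection happens at all, the least time is attained and monotonicity gives the
  equivalence. Elsewhere \<open>LEAST\<close> is unspecified, so the events are compared almost
  everywhere only.\<close>

lemma prob_detection_time_le:
  "\<P>(\<omega> in M. detection_time m n X \<omega> \<le> T) = prob (all_detected m T)"
proof (rule finite_measure_eq_AE)
  show "AE \<omega> in M. \<omega> \<in> {\<omega> \<in> space M. detection_time m n X \<omega> \<le> T} \<longleftrightarrow> \<omega> \<in> all_detected m T"
    using AE_detected[of m] AE_space
  proof eventually_elim
    case (elim \<omega>)
    have D: "detection_time m n X \<omega> = (LEAST T. \<omega> \<in> all_detected m T)"
      using elim by (simp add: detection_time_def all_detected_def)
    have "\<omega> \<in> all_detected m (detection_time m n X \<omega>)"
      unfolding D using elim(1) by (rule LeastI_ex)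
    then have "\<omega> \<in> all_detected m T" if "detection_time m n X \<omega> \<le> T"
      using all_detected_mono[OF that] by blast
    moreover have "detection_time m n X \<omega> \<le> T" if "\<omega> \<in> all_detected m T"
      unfolding D using that by (rule Least_le)
    ultimately show ?case using elim by blast
  qed
  show "{\<omega> \<in> space M. detection_time m n X \<omega> \<le> T} \<in> events"
    using detection_time_measurable[measurable] by measurable
qed auto

lemma mono_prob_all_detected: "mono (\<lambda>T. prob (all_detected m T))"
  by (intro monoI finite_measure_mono all_detected_mono all_detected_events)

lemma detection_lower:
  assumes "0 \<le> \<mu>" "\<mu> < real T"
  shows "(1 - poisson_below m (\<mu> / real n)) ^ n - \<mu> / (real T - \<mu>)\<^sup>2 \<le> prob (all_detected m T)"
  by (rule poisson_average_lower[OF _ _ _ _ poisson_average_all_detected])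
    (use assms mono_prob_all_detected in auto)

lemma detection_upper:
  assumes "real T < \<mu>"
  shows "prob (all_detected m T) \<le> (1 - poisson_below m (\<mu> / real n)) ^ n + \<mu> / (\<mu> - real T)\<^sup>2"
  by (rule poisson_average_upper[OF _ _ _ _ poisson_average_all_detected])
    (use assms mono_prob_all_detected in auto)

end

text \<open>The probability is squeezed between Poisson averages with means
  \<open>b n (y n - \<delta> n)\<close> and \<open>b n (y n + \<delta> n)\<close>. These lie
  \<open>h n\<close> before and after the target time; both averages have the same limit.\<close>

lemma detection_time_limit:
  fixes m :: "nat \<Rightarrow> nat" and M :: "nat \<Rightarrow> 'a measure" and X :: "nat \<Rightarrow> nat \<Rightarrow> 'a \<Rightarrow> nat"
  assumes m_top: "filterlim m at_top sequentially"
    and m_growth: "(\<lambda>n. (ln (real n)) ^ 3 / real (m n)) \<longlonglongrightarrow> 0"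
    and coupons: "\<And>n. n \<ge> 1 \<Longrightarrow> coupon_collector (M n) n (X n)"
    and y: "y \<longlonglongrightarrow> c"
  shows "(\<lambda>n. \<P>(\<omega> in M n. real (detection_time (m n) n (X n) \<omega>)
      \<le> real n * (real (m n) + sqrt (real (m n)) * threshold n (y n)))) \<longlonglongrightarrow> exp (- (exp (- c) / (2 * sqrt pi)))"
    (is "?P \<longlonglongrightarrow> ?c")
proof -
  define b where "b n z = real n * (real (m n) + sqrt (real (m n)) * threshold n z)" for n z
  \<comment> \<open>Small enough not to change the limit, large enough that the time shift \<open>h n\<close> exceeds the
    Poisson standard deviation by a factor tending to infinity.\<close>
  define \<delta> where "\<delta> n = 1 / ln (real n)" for n
  define h where "h n = real n * sqrt (real (m n)) * \<delta> n / sqrt (2 * ln (real n))" for n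
  define G where "G n z = (1 - poisson_below (m n) (real (m n) + sqrt (real (m n)) * threshold n z)) ^ n" for n z
  \<comment> \<open>The Chebyshev error: a mean of at most \<open>2 * n * m\<close>, divided by
    \<open>(h n / 2)^2\<close>, where \<open>(h n)^2 = n^2 * m / (2 * (ln n)^3)\<close>.\<close>
  define e where "e n = 16 * ln (real n) ^ 3 / real n" for n
  have \<delta>: "\<delta> \<longlonglongrightarrow> 0" unfolding \<delta>_def by real_asymp
  have y': "(\<lambda>n. y n - \<delta> n) \<longlonglongrightarrow> c" "(\<lambda>n. y n + \<delta> n) \<longlonglongrightarrow> c"
    using tendsto_diff[OF y \<delta>] tendsto_add[OF y \<delta>] by simp_all
  have G: "(\<lambda>n. G n (y n - \<delta> n)) \<longlonglongrightarrow> ?c" "(\<lambda>n. G n (y n + \<delta> n)) \<longlonglongrightarrow> ?c"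
    unfolding G_def by (intro poissonized_limit y' m_top m_growth)+
  have e: "e \<longlonglongrightarrow> 0" unfolding e_def by real_asymp
  have m1: "\<forall>\<^sub>F n in sequentially. m n \<ge> 1"
    using m_top by (simp add: filterlim_at_top)
  \<comment> \<open>Rounding the target time down to an integer costs less than 1, and
    \<open>h n \<ge> 2\<close> leaves a distance of at least \<open>h n / 2\<close> to either
    mean.\<close>
  have h2: "\<forall>\<^sub>F n in sequentially. h n \<ge> 2"
  proof -
    have "\<forall>\<^sub>F n in sequentially. real n * \<delta> n / sqrt (2 * ln (real n)) \<ge> 2"
      unfolding \<delta>_def by real_asymp
    then show ?thesis using m1
    proof eventually_elim
      case (elim n)
      have "2 \<le> real n * \<delta> n / sqrt (2 * ln (real n)) * 1" using elim by simp
      also have "\<dots> \<le> real n * \<delta> n / sqrt (2 * ln (real n)) * sqrt (real (m n))"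
        using elim by (intro mult_left_mono) auto
      finally show ?case by (simp add: h_def mult_ac)
    qed
  qed
  have b_bounds: "\<forall>\<^sub>F n in sequentially. 0 \<le> b n (z n) \<and> b n (z n) \<le> 2 * real n * real (m n)"
    if z: "z \<longlonglongrightarrow> c" for z
  proof -
    have "(\<lambda>n. threshold n (z n) / sqrt (real (m n))) \<longlonglongrightarrow> 0"
      by (rule a_over_sqrt_m[OF m_top threshold_at_top[OF z] threshold_cube[OF z m_growth]])
    then have "\<forall>\<^sub>F n in sequentially. threshold n (z n) / sqrt (real (m n)) < 1"
      by (rule order_tendstoD) simp
    moreover have "\<forall>\<^sub>F n in sequentially. threshold n (z n) \<ge> 0"
      using threshold_at_top[OF z] by (simp add: filterlim_at_top)
    ultimately show ?thesis using m1
    proof eventually_elim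
      case (elim n)
      have "sqrt (real (m n)) * threshold n (z n) \<le> sqrt (real (m n)) * sqrt (real (m n))"
        using elim by (intro mult_left_mono) (auto simp: divide_simps)
      then have "b n (z n) \<le> real n * (real (m n) + real (m n))"
        unfolding b_def by (intro mult_left_mono) auto
      then show ?case using elim by (simp add: b_def)
    qed
  qed
  have shift: "b n (z + d) = b n z + real n * sqrt (real (m n)) * d / sqrt (2 * ln (real n))" for n z d
    by (simp add: b_def threshold_def algebra_simps add_divide_distrib)
  have err: "t / d\<^sup>2 \<le> e n"
    if "t \<le> 2 * real n * real (m n)" "h n / 2 \<le> d" "h n \<ge> 2" "n > 1" "m n \<ge> 1" for n t d
  proof -
    have "t / d\<^sup>2 \<le> 2 * real n * real (m n) / d\<^sup>2" using that by (intro divide_right_mono) auto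
    also have "\<dots> \<le> 2 * real n * real (m n) / (h n / 2)\<^sup>2"
      using that by (intro divide_left_mono power_mono mult_pos_pos) auto
    also have "\<dots> = e n"
      using that by (simp add: h_def e_def \<delta>_def power_divide power_mult_distrib field_simps power2_eq_square power3_eq_cube)
    finally show ?thesis .
  qed
  have main: "\<forall>\<^sub>F n in sequentially. G n (y n - \<delta> n) - e n \<le> ?P n \<and> ?P n \<le> G n (y n + \<delta> n) + e n"
    using b_bounds[OF y] b_bounds[OF y'(1)] b_bounds[OF y'(2)] h2 m1 eventually_gt_at_top[of 1]
  proof eventually_elim
    case (elim n)
    interpret coupon_collector "M n" n "X n" using elim by (intro coupons) auto
    define T where "T = nat \<lfloor>b n (y n)\<rfloor>"
    have T: "real T \<le> b n (y n)" "b n (y n) < real T + 1" using elim by (auto simp: T_def)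
    have "real D \<le> b n (y n) \<longleftrightarrow> D \<le> T" for D :: nat
      using T by (cases "D \<le> T") linarith+
    then have P: "?P n = prob (all_detected (m n) T)"
      unfolding prob_detection_time_le[symmetric] b_def[symmetric] by simp
    have bm: "b n (y n - \<delta> n) = b n (y n) - h n" using shift[of n "y n" "- \<delta> n"] by (simp add: h_def)
    have bp: "b n (y n + \<delta> n) = b n (y n) + h n" using shift[of n "y n" "\<delta> n"] by (simp add: h_def)
    have quot: "b n z / real n = real (m n) + sqrt (real (m n)) * threshold n z" for z
      using elim by (simp add: b_def)
    have "(1 - poisson_below (m n) (b n (y n - \<delta> n) / real n)) ^ n
        - b n (y n - \<delta> n) / (real T - b n (y n - \<delta> n))\<^sup>2 \<le> ?P n"
      unfolding P using elim T by (intro detection_lower) (auto simp: bm)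
    moreover have "b n (y n - \<delta> n) / (real T - b n (y n - \<delta> n))\<^sup>2 \<le> e n"
      using elim T by (intro err) (auto simp: bm)
    moreover have "?P n \<le> (1 - poisson_below (m n) (b n (y n + \<delta> n) / real n)) ^ n
        + b n (y n + \<delta> n) / (b n (y n + \<delta> n) - real T)\<^sup>2"
      unfolding P using elim T by (intro detection_upper) (auto simp: bp)
    moreover have "b n (y n + \<delta> n) / (b n (y n + \<delta> n) - real T)\<^sup>2 \<le> e n"
      using elim T by (intro err) (auto simp: bp)
    ultimately show ?case unfolding quot G_def by linarith
  qed
  show ?thesis
  proof (rule tendsto_sandwich)
    show "(\<lambda>n. G n (y n - \<delta> n) - e n) \<longlonglongrightarrow> ?c" using tendsto_diff[OF G(1) e] by simp
    show "(\<lambda>n. G n (y n + \<delta> n) + e n) \<longlonglongrightarrow> ?c" using tendsto_add[OF G(2) e] by simp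
  qed (use main in \<open>auto elim: eventually_mono\<close>)
qed

text \<open>Both claims rewrite the event into the form of \<open>detection_time_limit\<close>: the
  first with constant \<open>y\<close>, the second with a sequence converging to
  \<open>z - ln (2 * sqrt pi)\<close>.\<close>

theorem theorem4:
  fixes m :: "nat \<Rightarrow> nat"
    and M :: "nat \<Rightarrow> 'a measure"
    and X :: "nat \<Rightarrow> nat \<Rightarrow> 'a \<Rightarrow> nat"
  assumes m_pos: "\<And>n. n \<ge> 1 \<Longrightarrow> m n \<ge> 1"
    and m_growth: "(\<lambda>n. (ln (real n)) ^ 3 / real (m n)) \<longlonglongrightarrow> 0"
    and coupons: "\<And>n. n \<ge> 1 \<Longrightarrow> coupon_collector (M n) n (X n)"
  shows "(\<forall>y::real.
      (\<lambda>n. \<P>(\<omega> in M n.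
          (real (detection_time (m n) n (X n) \<omega>) - real n * real (m n)
             - real n * sqrt (real (m n)) * sqrt (2 * ln (real n) - ln (ln (real n))))
          / (real n * sqrt (real (m n) / (2 * ln (real n)))) \<le> y))
        \<longlonglongrightarrow> exp (- (exp (- y) / (2 * sqrt pi))))
    \<and> weak_conv_m
        (\<lambda>n. distr (M n) borel (\<lambda>\<omega>.
          sqrt (2 * real (m n) * ln (real n)) * (real (detection_time (m n) n (X n) \<omega>) / (real n * real (m n)) - 1)
            - 2 * ln (real n) + ln (ln (real n)) / 2 + ln (2 * sqrt pi)))
        gumbel"
proof (intro conjI allI)
  have m_top: "filterlim m at_top sequentially"
  proof (rule filterlim_at_top_mono)
    show "filterlim (\<lambda>n. nat \<lfloor>ln (real n) ^ 3\<rfloor>) at_top sequentially"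
      by (intro filterlim_compose[OF filterlim_nat_sequentially] filterlim_compose[OF filterlim_floor_sequentially]) real_asymp
    have "\<forall>\<^sub>F n in sequentially. ln (real n) ^ 3 / real (m n) < 1"
      using m_growth by (rule order_tendstoD) simp
    then show "\<forall>\<^sub>F n in sequentially. nat \<lfloor>ln (real n) ^ 3\<rfloor> \<le> m n"
      using eventually_ge_at_top[of 1]
    proof eventually_elim
      case (elim n)
      \<comment> \<open>Positivity of \<open>m n\<close> matters: for \<open>m n = 0\<close> the
        quotient would be 0 by convention and bound nothing.\<close>
      then have "ln (real n) ^ 3 < real (m n)" using m_pos[of n] by (simp add: divide_simps)
      then show ?case by (simp add: nat_le_iff floor_le_iff)
    qed
  qed
  note limit = detection_time_limit[OF m_top m_growth coupons]
  let ?L = "\<lambda>n. ln (real n)"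
  {
    fix y :: real
    have "\<forall>\<^sub>F n in sequentially. \<P>(\<omega> in M n. real (detection_time (m n) n (X n) \<omega>)
        \<le> real n * (real (m n) + sqrt (real (m n)) * threshold n y)) =
      \<P>(\<omega> in M n. (real (detection_time (m n) n (X n) \<omega>) - real n * real (m n)
             - real n * sqrt (real (m n)) * sqrt (2 * ?L n - ln (?L n)))
          / (real n * sqrt (real (m n) / (2 * ?L n))) \<le> y)"
      using eventually_gt_at_top[of 1]
    proof eventually_elim
      case (elim n)
      define v where "v = sqrt (2 * ?L n)"
      have pos: "v > 0" "m n > 0" "n > 0" using elim m_pos[of n] by (auto simp: v_def)
      define s u where "s = sqrt (real (m n))" and "u = sqrt (2 * ?L n - ln (?L n))"
      have "s > 0" using pos by (simp add: s_def)
      have "(D - real n * real (m n) - real n * s * u) / (real n * (s / v)) \<le> y \<longleftrightarrow>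
          D - real n * real (m n) - real n * s * u \<le> y * (real n * (s / v))" for D
        using pos \<open>s > 0\<close> by (intro pos_divide_le_eq) simp
      also have "D - real n * real (m n) - real n * s * u \<le> y * (real n * (s / v)) \<longleftrightarrow>
          D \<le> real n * (real (m n) + s * (u + y / v))" for D
        by (simp add: algebra_simps)
      finally have "(D - real n * real (m n) - real n * s * u) / (real n * sqrt (real (m n) / (2 * ?L n))) \<le> y \<longleftrightarrow>
          D \<le> real n * (real (m n) + s * threshold n y)" for D
        unfolding threshold_def real_sqrt_divide v_def[symmetric] s_def[symmetric] u_def[symmetric] .
      then show ?case unfolding s_def u_def by simp
    qed
    then show "(\<lambda>n. \<P>(\<omega> in M n. (real (detection_time (m n) n (X n) \<omega>) - real n * real (m n)
             - real n * sqrt (real (m n)) * sqrt (2 * ?L n - ln (?L n)))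
          / (real n * sqrt (real (m n) / (2 * ?L n))) \<le> y))
        \<longlonglongrightarrow> exp (- (exp (- y) / (2 * sqrt pi)))"
      using limit[of "\<lambda>_. y" y] by (auto intro: Lim_transform_eventually)
  }
  let ?Z = "\<lambda>n \<omega>. sqrt (2 * real (m n) * ?L n) * (real (detection_time (m n) n (X n) \<omega>) / (real n * real (m n)) - 1)
            - 2 * ?L n + ln (?L n) / 2 + ln (2 * sqrt pi)"
  show "weak_conv_m (\<lambda>n. distr (M n) borel (?Z n)) gumbel"
    unfolding weak_conv_m_def weak_conv_def
  proof (intro allI impI)
    fix z :: real
    \<comment> \<open>Chosen so that \<open>threshold n (y n)\<close> equals \<open>(z - ln (2 *
      sqrt pi) + 2 * ln n - ln (ln n) / 2) / sqrt (2 * ln n)\<close>, which makes the two events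
      coincide exactly. The bracket measures how far the two centerings differ and tends to
      0.\<close>
    define y where "y n = z - ln (2 * sqrt pi)
      - (sqrt (2 * ?L n) * sqrt (2 * ?L n - ln (?L n)) - 2 * ?L n + ln (?L n) / 2)" for n
    \<comment> \<open>The bracket in terms of \<open>x = 2 * ln n\<close>, with the two square roots
      merged into one.\<close>
    have "((\<lambda>x::real. sqrt (x * (x - ln (x / 2))) - x + ln (x / 2) / 2) \<longlongrightarrow> 0) at_top"
      by real_asymp
    moreover have "filterlim (\<lambda>n. 2 * ?L n) at_top sequentially" by real_asymp
    ultimately have "(\<lambda>n. sqrt (2 * ?L n * (2 * ?L n - ln (2 * ?L n / 2))) - 2 * ?L n + ln (2 * ?L n / 2) / 2)
        \<longlonglongrightarrow> 0"
      by (rule filterlim_compose)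
    then have "(\<lambda>n. sqrt (2 * ?L n) * sqrt (2 * ?L n - ln (?L n)) - 2 * ?L n + ln (?L n) / 2) \<longlonglongrightarrow> 0"
      by (simp only: real_sqrt_mult[symmetric]) simp
    then have y: "y \<longlonglongrightarrow> z - ln (2 * sqrt pi) - 0"
      unfolding y_def by (intro tendsto_intros)
    \<comment> \<open>The shift by \<open>ln (2 * sqrt pi)\<close> absorbs the constant of the first
      limit and leaves the standard Gumbel law.\<close>
    have "exp (- (z - ln (2 * sqrt pi))) = exp (- z + ln (2 * sqrt pi))" by simp
    then have "exp (- (z - ln (2 * sqrt pi))) / (2 * sqrt pi) = exp (- z)"
      unfolding exp_add by simp
    with limit[OF _ y] have "(\<lambda>n. \<P>(\<omega> in M n. real (detection_time (m n) n (X n) \<omega>)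
        \<le> real n * (real (m n) + sqrt (real (m n)) * threshold n (y n)))) \<longlonglongrightarrow> cdf gumbel z"
      by (simp add: cdf_gumbel)
    moreover have "\<forall>\<^sub>F n in sequentially. \<P>(\<omega> in M n. real (detection_time (m n) n (X n) \<omega>)
        \<le> real n * (real (m n) + sqrt (real (m n)) * threshold n (y n))) = cdf (distr (M n) borel (?Z n)) z"
      using eventually_gt_at_top[of 1]
    proof eventually_elim
      case (elim n)
      interpret coupon_collector "M n" n "X n" using elim by (intro coupons) auto
      define v where "v = sqrt (2 * ?L n)"
      define s where "s = sqrt (real (m n))"
      have pos: "v > 0" "s > 0" "n > 0" and s2: "real (m n) = s * s"
        using elim m_pos[of n] by (auto simp: v_def s_def)
      have sv: "sqrt (2 * real (m n) * ?L n) = s * v"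
        by (simp add: s_def v_def real_sqrt_mult mult_ac)
      define A where "A = z - ln (2 * sqrt pi) + 2 * ?L n - ln (?L n) / 2"
      have "threshold n (y n) = A / v"
        unfolding threshold_def y_def v_def[symmetric] A_def using pos by (simp add: diff_divide_distrib add_divide_distrib)
      moreover have "s * v * (D / (real n * (s * s)) - 1) = (D - real n * (s * s)) / (real n * s / v)" for D
        using pos by (simp add: field_simps)
      moreover have "(D - real n * (s * s)) / (real n * s / v) \<le> A \<longleftrightarrow> D - real n * (s * s) \<le> A * (real n * s / v)" for D
        using pos by (intro pos_divide_le_eq) simp
      ultimately have "D \<le> real n * (real (m n) + s * threshold n (y n)) \<longleftrightarrow>
          s * v * (D / (real n * real (m n)) - 1) \<le> A" for D
        unfolding s2 by (simp add: algebra_simps)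
      then have "D \<le> real n * (real (m n) + s * threshold n (y n)) \<longleftrightarrow>
          s * v * (D / (real n * real (m n)) - 1) - 2 * ?L n + ln (?L n) / 2 + ln (2 * sqrt pi) \<le> z" for D
        unfolding A_def by (simp only:) linarith
      then have "{\<omega> \<in> space (M n). real (detection_time (m n) n (X n) \<omega>)
          \<le> real n * (real (m n) + s * threshold n (y n))} = ?Z n -` {..z} \<inter> space (M n)"
        unfolding sv by auto
      moreover have "?Z n \<in> borel_measurable (M n)"
        using detection_time_measurable[of "m n", measurable] by measurable
      ultimately show ?case by (simp add: cdf_def measure_distr s_def)
    qed
    ultimately show "(\<lambda>n. cdf (distr (M n) borel (?Z n)) z) \<longlonglongrightarrow> cdf gumbel z"
      by (rule Lim_transform_eventually)
  qed
qed


end
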